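(* Let $\widehat V:\mathcal A\to L^0(\mathcal F;\mathbb R^n\cup\{-\infty\})$ be an upper-semicontinuous ($\mathbb R^n$-valued) market model. Then there exists a mapping $V:\Omega\times\mathbb R^{dT}\to\mathbb R^n\cup\{-\infty\}$, measurable with respect to $\mathcal F\otimes\mathcal B(\mathbb R^{dT})$, such that for each $\vartheta\in\mathcal A$ $$\widehat V(\vartheta)(\omega)\sim_{K(\omega)}V(\omega,\vartheta(\omega))\quad\text{a.s.}$$
   Context: $(\Omega,\mathcal F,\mathbb P)$ is a probability space with a filtration $(\mathcal F_t)_{t=0,\dots,T}$, $\mathcal F_t\subseteq\mathcal F$. The set of strategies is $\mathcal A=\{(\vartheta_0,\dots,\vartheta_{T-1}) : \vartheta_t\in L^0(\Omega,\mathcal F_t,\mathbb P;\mathbb R^d)\ \forall t\}$, regarded as $\mathbb R^{dT}$-valued random vectors. An $\mathbb R^n$-valued market model is a mapping $\widehat V:\mathcal A\to L^0(\mathcal F;\mathbb R^n\cup\{-\infty\})$, where $-\infty$ is a single point appended to $\mathbb R^n$, such that (A1) $\widehat V(0)=0$ a.s.; (A2) for all $t$, $A\in\mathcal F_t$, $\vartheta\in\mathcal A$: $\widehat V(\vartheta)$ and $\widehat V(\vartheta_0,\dots,\vartheta_{t-1},\vartheta_t\mathbf 1_A,\vartheta_{t+1},\dots,\vartheta_{T-1})$ coincide a.s. on $A$. $K:\Omega\rightrightarrows\mathbb R^n$ is a fixed $\mathcal F$ measurable set-valued map whose values are closed convex cones with $\operatorname{int}K(\omega)\ne\varnothing$ for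 almost all $\omega$ (measurable: $\{\omega:K(\omega)\cap O\neq\varnothing\}\in\mathcal F$ for each open $O$). For $a,b\in\mathbb R^n$, $a\succeq_{K(\omega)}b$ iff $a-b\in K(\omega)$; moreover every element satisfies $a\succeq_{K(\omega)}-\infty$, and $-\infty\succeq_{K(\omega)} a$ fails for $a\in\mathbb R^n$; $a\sim_{K(\omega)}b$ means $a\succeq_{K(\omega)}b$ and $b\succeq_{K(\omega)}a$. The positive polar is $K^\circ(\omega)=\{y\in\mathbb R^n:\langle x,y\rangle\ge0\ \forall x\in K(\omega)\}$; $\operatorname{ri}$ is relative interior; $L^0(\mathcal F;\operatorname{ri}K^\circ)$ is the set of $\mathcal F$ measurable selections of $\operatorname{ri}K^\circ$; and $\langle Z,-\infty\rangle:=-\infty$. $\widehat V$ is upper-semicontinuous if for every $Z\in L^0(\mathcal F;\operatorname{ri}K^\circ)$ the scalar mapping $\widehat V_Z:\mathcal A\to L^0(\mathcal F;\mathbb R\cup\{-\infty\})$, $\widehat V_Z(\vartheta)=\langle Z,\widehat V(\vartheta)\rangle$, satisfies $\limsup_n\widehat V_Z(\vartheta_n)\le\widehat V_Z(\vartheta)$ a.s. for every sequence $\vartheta_n\in\mathcal A\cap L^\infty$ converging in $L^\infty$ to $\vartheta\in\mathcal A$. *)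

theory Defs
  imports "HOL-Probability.Probability"
begin

(* R^n with the single point -infinity appended is "(real^'n) option": None is -infinity and
   Some x is the vector x. A set is measurable iff its trace on R^n is Borel. *)

type_synonym 'n vec_minf = "(real ^ 'n) option"

definition vec_minf_borel :: "('n::finite) vec_minf measure" where
  "vec_minf_borel = sigma UNIV {A. Some -` A \<in> sets borel}"

lemma space_vec_minf_borel: "space vec_minf_borel = UNIV"
  by (simp add: vec_minf_borel_def)

lemma sets_vec_minf_borel:
  "sets (vec_minf_borel :: ('n::finite) vec_minf measure) = {A. Some -` A \<in> sets borel}"
proof -
  have "sigma_algebra UNIV {A :: 'n vec_minf set. Some -` A \<in> sets borel}"
    unfolding sigma_algebra_iff2 by (auto simp: vimage_Union vimage_Compl Compl_eq_Diff_UNIV[symmetric])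
  then show ?thesis
    by (simp add: vec_minf_borel_def sigma_algebra.sigma_sets_eq)
qed

definition positive_polar :: "(real ^ 'n) set \<Rightarrow> (real ^ 'n) set" where
  "positive_polar C = {y. \<forall>x\<in>C. 0 \<le> x \<bullet> y}"

definition cone_geq :: "(real ^ 'n) set \<Rightarrow> 'n vec_minf \<Rightarrow> 'n vec_minf \<Rightarrow> bool" where
  "cone_geq C a b = (case b of None \<Rightarrow> True
     | Some y \<Rightarrow> (case a of None \<Rightarrow> False | Some x \<Rightarrow> x - y \<in> C))"

definition cone_equiv :: "(real ^ 'n) set \<Rightarrow> 'n vec_minf \<Rightarrow> 'n vec_minf \<Rightarrow> bool" where
  "cone_equiv C a b \<longleftrightarrow> cone_geq C a b \<and> cone_geq C b a"

(* The pairing with -infinity is -infinity for every z, including z = 0. *)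

definition inner_minf :: "real ^ 'n \<Rightarrow> 'n vec_minf \<Rightarrow> ereal" where
  "inner_minf z a = (case a of None \<Rightarrow> - \<infinity> | Some x \<Rightarrow> ereal (z \<bullet> x))"

definition measurable_set_map :: "'a measure \<Rightarrow> ('a \<Rightarrow> 'b::topological_space set) \<Rightarrow> bool" where
  "measurable_set_map M K \<longleftrightarrow> (\<forall>U. open U \<longrightarrow> {\<omega>\<in>space M. K \<omega> \<inter> U \<noteq> {}} \<in> sets M)"

(* The library's cones may be empty, hence the separate nonemptiness condition. *)

definition solid_cone_map :: "'a measure \<Rightarrow> ('a \<Rightarrow> (real ^ 'n) set) \<Rightarrow> bool" where
  "solid_cone_map M K \<longleftrightarrow> measurable_set_map M K
     \<and> (\<forall>\<omega>\<in>space M. closed (K \<omega>) \<and> convex (K \<omega>) \<and> cone (K \<omega>) \<and> K \<omega> \<noteq> {})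
     \<and> (AE \<omega> in M. interior (K \<omega>) \<noteq> {})"

definition finite_filtration :: "'a measure \<Rightarrow> nat \<Rightarrow> (nat \<Rightarrow> 'a measure) \<Rightarrow> bool" where
  "finite_filtration M T F \<longleftrightarrow> (\<forall>t\<le>T. subalgebra M (F t))
     \<and> (\<forall>s t. s \<le> t \<and> t \<le> T \<longrightarrow> sets (F s) \<subseteq> sets (F t))"

(* A strategy is given by representatives theta t of its components for t < T; the values
   theta t with t >= T play no role. *)

type_synonym ('a, 'd) strat = "nat \<Rightarrow> 'a \<Rightarrow> real ^ 'd"

definition strategies :: "nat \<Rightarrow> (nat \<Rightarrow> 'a measure) \<Rightarrow> ('a, 'd::finite) strat set" where
  "strategies T F = {\<theta>. \<forall>t<T. \<theta> t \<in> borel_measurable (F t)}"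

(* R^(dT) is the extensional product over {..<T} of copies of R^d; its Borel sigma-algebra is
   the corresponding finite product of Borel sigma-algebras. *)

definition strat_borel :: "nat \<Rightarrow> (nat \<Rightarrow> real ^ ('d::finite)) measure" where
  "strat_borel T = Pi\<^sub>M {..<T} (\<lambda>_. borel)"

definition strat_vector :: "nat \<Rightarrow> ('a, 'd) strat \<Rightarrow> 'a \<Rightarrow> nat \<Rightarrow> real ^ 'd" where
  "strat_vector T \<theta> \<omega> = (\<lambda>t\<in>{..<T}. \<theta> t \<omega>)"

(* The L2_set term is the Euclidean norm on R^(dT). *)

definition Linf_norm :: "'a measure \<Rightarrow> nat \<Rightarrow> ('a, 'd::finite) strat \<Rightarrow> ereal" where
  "Linf_norm M T \<theta> = esssup M (\<lambda>\<omega>. ereal (L2_set (\<lambda>t. norm (\<theta> t \<omega>)) {..<T}))"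

(* The first two conditions say that V induces a map from strategies modulo a.s. equality to
   L^0(M; R^n with -infinity). *)

definition market_model ::
  "'a measure \<Rightarrow> nat \<Rightarrow> (nat \<Rightarrow> 'a measure) \<Rightarrow>
     (('a, 'd::finite) strat \<Rightarrow> 'a \<Rightarrow> ('n::finite) vec_minf) \<Rightarrow> bool" where
  "market_model M T F V \<longleftrightarrow>
     (\<forall>\<theta>\<in>strategies T F. V \<theta> \<in> M \<rightarrow>\<^sub>M vec_minf_borel)
   \<and> (\<forall>\<theta>\<in>strategies T F. \<forall>\<theta>'\<in>strategies T F.
        (\<forall>t<T. AE \<omega> in M. \<theta> t \<omega> = \<theta>' t \<omega>) \<longrightarrow> (AE \<omega> in M. V \<theta> \<omega> = V \<theta>' \<omega>))
   \<and> (AE \<omega> in M. V (\<lambda>t \<omega>. 0) \<omega> = Some 0)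
   \<and> (\<forall>t<T. \<forall>A\<in>sets (F t). \<forall>\<theta>\<in>strategies T F.
        AE \<omega> in M. \<omega> \<in> A \<longrightarrow>
          V \<theta> \<omega> = V (\<theta>(t := (\<lambda>\<omega>. indicator A \<omega> *\<^sub>R \<theta> t \<omega>))) \<omega>)"

definition upper_semicontinuous_model ::
  "'a measure \<Rightarrow> nat \<Rightarrow> (nat \<Rightarrow> 'a measure) \<Rightarrow> ('a \<Rightarrow> (real ^ 'n) set) \<Rightarrow>
     (('a, 'd::finite) strat \<Rightarrow> 'a \<Rightarrow> ('n::finite) vec_minf) \<Rightarrow> bool" where
  "upper_semicontinuous_model M T F K V \<longleftrightarrow>
     (\<forall>Z\<in>borel_measurable M. (AE \<omega> in M. Z \<omega> \<in> rel_interior (positive_polar (K \<omega>))) \<longrightarrow>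
       (\<forall>\<theta>s. \<forall>\<theta>\<in>strategies T F.
          (\<forall>m::nat. \<theta>s m \<in> strategies T F \<and> Linf_norm M T (\<theta>s m) < \<infinity>)
          \<and> (\<lambda>m. Linf_norm M T (\<lambda>t \<omega>. \<theta>s m t \<omega> - \<theta> t \<omega>)) \<longlonglongrightarrow> 0 \<longrightarrow>
          (AE \<omega> in M. limsup (\<lambda>m. inner_minf (Z \<omega>) (V (\<theta>s m) \<omega>))
                        \<le> inner_minf (Z \<omega>) (V \<theta> \<omega>))))"

end

theory Submission
  imports Defs
begin

text \<open>
  Scalar case: for \<open>W = \<langle>Z, Vhat\<rangle>\<close> partition \<open>\<real>\<^sup>d\<close> into countably many small cells and take, for every
  time-indexed family of cells, the essential supremum of \<open>W\<close> over the strategies that stay in these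
  cells; the infimum over the cell sizes is the candidate \<open>v(\<omega>, x)\<close>. Locality gives
  \<open>W \<theta> \<le> v(\<cdot>, \<theta>)\<close>. Conversely, replacing \<open>\<theta>\<^sub>t\<close>, separately for each \<open>t\<close>, by the component of another strategy
  wherever the two share a cell keeps adaptedness, so \<open>v(\<cdot>, \<theta>)\<close> is bounded by a limit of suprema of \<open>W\<close> over countably
  many strategies uniformly close to \<open>\<theta>\<close>, and upper semicontinuity yields \<open>v(\<cdot>, \<theta>) \<le> W \<theta>\<close>.

  Vector case: choose a measurable \<open>z\<close> in the relative interior of the polar cone, the projections
  \<open>P\<^sub>i\<close> of the unit vectors onto the span of the polar cone, and integers \<open>N\<^sub>i\<close> with
  \<open>P\<^sub>i + N\<^sub>i z\<close> again in the relative interior. The scalar representations for \<open>z\<close> and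
  \<open>P\<^sub>i + N\<^sub>i z\<close> determine \<open>\<langle>P\<^sub>i, Vhat\<rangle>\<close>, hence the projection of \<open>Vhat\<close> onto that span, which by the
  bipolar theorem is \<open>K\<close>-equivalent to \<open>Vhat\<close>.
\<close>

section \<open>Essential suprema\<close>

text \<open>Exhaustion argument: among countable subfamilies the measure of the union has a finite
  supremum, and some countable subfamily attains it. Adjoining one more set cannot increase the
  measure, so that set is covered up to a null set.\<close>

lemma (in finite_measure) countable_essential_union:
  assumes S: "\<And>i. i \<in> I \<Longrightarrow> S i \<in> sets M"
  obtains C where "countable C" "C \<subseteq> I"
    "\<And>i. i \<in> I \<Longrightarrow> AE \<omega> in M. \<omega> \<in> S i \<longrightarrow> (\<exists>j\<in>C. \<omega> \<in> S j)"
proof -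
  define \<D> where "\<D> = {D. countable D \<and> D \<subseteq> I}"
  define \<mu> where "\<mu> D = measure M (\<Union>j\<in>D. S j)" for D
  define c where "c = (SUP D\<in>\<D>. \<mu> D)"
  have ne: "\<D> \<noteq> {}" unfolding \<D>_def using countable_empty by blast
  have bdd: "bdd_above (\<mu> ` \<D>)"
    unfolding \<mu>_def using bounded_measure by (auto intro: bdd_aboveI[of _ "measure M (space M)"])
  have sets: "(\<Union>j\<in>D. S j) \<in> sets M" if "D \<in> \<D>" for D
    using that S unfolding \<D>_def by (intro sets.countable_UN') blast+
  have "\<exists>D\<in>\<D>. c - 1 / real (Suc n) < \<mu> D" for n
    using less_cSUP_iff[OF ne bdd, of "c - 1 / real (Suc n)"] unfolding c_def[symmetric] by simp
  then obtain D where D: "\<And>n. D n \<in> \<D>" "\<And>n. c - 1 / real (Suc n) < \<mu> (D n)"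
    by metis
  \<comment> \<open>Uniting a sequence of near-maximisers stays countable and attains the supremum
    \<open>c\<close>.\<close>
  define C where "C = (\<Union>n. D n)"
  have C: "C \<in> \<D>" using D(1) unfolding \<D>_def C_def by auto
  have "c \<le> \<mu> C"
  proof (rule field_le_epsilon)
    fix e :: real assume "0 < e"
    then obtain n where "1 / real (Suc n) < e" using nat_approx_posE by blast
    moreover have "\<mu> (D n) \<le> \<mu> C"
      unfolding \<mu>_def by (rule finite_measure_mono) (use sets[OF C] in \<open>auto simp: C_def\<close>)
    ultimately show "c \<le> \<mu> C + e" using D(2)[of n] by linarith
  qed
  show thesis
  proof (rule that[of C])
    show "countable C" "C \<subseteq> I" using C by (auto simp: \<D>_def)
    fix i assume i: "i \<in> I"
    let ?U = "\<Union>j\<in>C. S j"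
    have iC: "insert i C \<in> \<D>" using C i by (auto simp: \<D>_def)
    have "\<mu> (insert i C) \<le> c" unfolding c_def by (rule cSUP_upper[OF iC bdd])
    moreover have "\<mu> (insert i C) = \<mu> C + measure M (S i - ?U)"
    proof -
      have "(\<Union>j\<in>insert i C. S j) = ?U \<union> (S i - ?U)" by auto
      then show ?thesis unfolding \<mu>_def
        using sets[OF C] S[OF i] by (auto intro!: finite_measure_Union simp del: Un_Diff_cancel)
    qed
    ultimately have "measure M (S i - ?U) = 0"
      using \<open>c \<le> \<mu> C\<close> measure_nonneg[of M "S i - ?U"] by linarith
    then have "S i - ?U \<in> null_sets M"
      using sets[OF C] S[OF i] by (intro null_setsI) (auto simp: emeasure_eq_measure)
    from AE_not_in[OF this] show "AE \<omega> in M. \<omega> \<in> S i \<longrightarrow> (\<exists>j\<in>C. \<omega> \<in> S j)"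
      by eventually_elim auto
  qed
qed

text \<open>The superlevel sets at each rational level are exhausted by countably many indices, and
  these index sets are united over all levels. A strict failure of the inequality would leave room
  for a rational level, contradicting the covering at that level.\<close>

lemma (in finite_measure) countable_essential_supremum:
  fixes f :: "'i \<Rightarrow> 'a \<Rightarrow> ereal"
  assumes f: "\<And>i. i \<in> I \<Longrightarrow> f i \<in> borel_measurable M"
  obtains C where "countable C" "C \<subseteq> I" "\<And>i. i \<in> I \<Longrightarrow> AE \<omega> in M. f i \<omega> \<le> (SUP j\<in>C. f j \<omega>)"
proof -
  define S where "S r i = {\<omega> \<in> space M. ereal (real_of_rat r) < f i \<omega>}" for r i
  have S: "S r i \<in> sets M" if i: "i \<in> I" for r i
  proof -
    note f[OF i, measurable]
    show ?thesis unfolding S_def by measurable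
  qed
  have "\<exists>C. countable C \<and> C \<subseteq> I \<and>
      (\<forall>i\<in>I. AE \<omega> in M. \<omega> \<in> S r i \<longrightarrow> (\<exists>j\<in>C. \<omega> \<in> S r j))" for r
  proof (rule countable_essential_union[of I "S r"])
    show "\<exists>C. countable C \<and> C \<subseteq> I \<and>
      (\<forall>i\<in>I. AE \<omega> in M. \<omega> \<in> S r i \<longrightarrow> (\<exists>j\<in>C. \<omega> \<in> S r j))"
      if "countable C" "C \<subseteq> I"
        "\<And>i. i \<in> I \<Longrightarrow> AE \<omega> in M. \<omega> \<in> S r i \<longrightarrow> (\<exists>j\<in>C. \<omega> \<in> S r j)" for C
      using that by (intro exI[of _ C]) simp
  qed (rule S)
  then obtain C where C': "\<forall>r. countable (C r) \<and> C r \<subseteq> I \<and>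
      (\<forall>i\<in>I. AE \<omega> in M. \<omega> \<in> S r i \<longrightarrow> (\<exists>j\<in>C r. \<omega> \<in> S r j))"
    using choice[of "\<lambda>r C. countable C \<and> C \<subseteq> I \<and>
      (\<forall>i\<in>I. AE \<omega> in M. \<omega> \<in> S r i \<longrightarrow> (\<exists>j\<in>C. \<omega> \<in> S r j))"] by auto
  then have C: "\<And>r. countable (C r)" "\<And>r. C r \<subseteq> I"
      "\<And>r i. i \<in> I \<Longrightarrow> AE \<omega> in M. \<omega> \<in> S r i \<longrightarrow> (\<exists>j\<in>C r. \<omega> \<in> S r j)"
    by auto
  show thesis
  proof (rule that[of "\<Union>r. C r"])
    show "countable (\<Union>r. C r)" "(\<Union>r. C r) \<subseteq> I" using C(1,2) by auto
    fix i assume i: "i \<in> I"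
    have "AE \<omega> in M. \<forall>r. \<omega> \<in> S r i \<longrightarrow> (\<exists>j\<in>C r. \<omega> \<in> S r j)"
      using C(3)[OF i] by (simp add: AE_all_countable)
    with AE_space show "AE \<omega> in M. f i \<omega> \<le> (SUP j\<in>\<Union>r. C r. f j \<omega>)"
    proof eventually_elim
      case (elim \<omega>)
      show ?case
      proof (rule ccontr)
        assume "\<not> ?thesis"
        then have "(SUP j\<in>\<Union>r. C r. f j \<omega>) < f i \<omega>" by (simp only: not_le)
        from ereal_dense3[OF this] obtain r where r: "(SUP j\<in>\<Union>r. C r. f j \<omega>) < ereal (real_of_rat r)"
            "ereal (real_of_rat r) < f i \<omega>"
          by blast
        then obtain j where "j \<in> C r" "ereal (real_of_rat r) < f j \<omega>"
          using elim by (auto simp: S_def)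
        then have "ereal (real_of_rat r) < (SUP j\<in>\<Union>r. C r. f j \<omega>)"
          by (subst less_SUP_iff) auto
        with r(1) show False by simp
      qed
    qed
  qed
qed

text \<open>A point is labelled by the first element of a dense sequence that is close to it. The
  radius is half of the required mesh, so the triangle inequality through the common dense point
  gives the distance bound.\<close>

lemma fine_countable_cells:
  obtains \<kappa> :: "nat \<Rightarrow> 'b::{second_countable_topology, metric_space} \<Rightarrow> nat"
  where "\<And>m. \<kappa> m \<in> borel \<rightarrow>\<^sub>M count_space UNIV"
    "\<And>m x y. \<kappa> m x = \<kappa> m y \<Longrightarrow> dist x y < 1 / real (Suc m)"
proof -
  obtain D :: "'b set" where D: "countable D" "\<And>X. open X \<Longrightarrow> X \<noteq> {} \<Longrightarrow> \<exists>d\<in>D. d \<in> X"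
    using countable_dense_setE by blast
  have ne: "D \<noteq> {}" using D(2)[of UNIV] by auto
  define \<kappa> where "\<kappa> m x = (LEAST k. dist x (from_nat_into D k) < 1 / (2 * real (Suc m)))" for m and x :: 'b
  have \<kappa>: "dist x (from_nat_into D (\<kappa> m x)) < 1 / (2 * real (Suc m))" for m x
  proof -
    obtain d where "d \<in> D" "dist x d < 1 / (2 * real (Suc m))"
      using D(2)[of "ball x (1 / (2 * real (Suc m)))"] by auto
    moreover then obtain k where "d = from_nat_into D k"
      using from_nat_into_surj[OF D(1)] by metis
    ultimately show ?thesis unfolding \<kappa>_def by (intro LeastI) auto
  qed
  show thesis
  proof (rule that[of \<kappa>])
    show "\<kappa> m \<in> borel \<rightarrow>\<^sub>M count_space UNIV" for m
      unfolding \<kappa>_def by measurable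
    fix m x y assume "\<kappa> m x = \<kappa> m y"
    then have "dist x y < 1 / (2 * real (Suc m)) + 1 / (2 * real (Suc m))"
      using \<kappa>[of x m] \<kappa>[of y m] dist_triangle2[of x y "from_nat_into D (\<kappa> m x)"] by simp
    then show "dist x y < 1 / real (Suc m)" by (simp add: field_simps)
  qed
qed

section \<open>Pointwise representation of scalar functionals\<close>

lemma (in prob_space) Linf_norm_nonneg: "0 \<le> Linf_norm M T f"
proof -
  have "esssup M (\<lambda>_. 0 :: ereal) \<le> Linf_norm M T f"
    unfolding Linf_norm_def by (intro esssup_mono) (auto simp: zero_ereal_def L2_set_nonneg)
  then show ?thesis by (simp add: esssup_const emeasure_space_1)
qed

lemma Linf_norm_le:
  assumes f: "\<And>t. t < T \<Longrightarrow> f t \<in> borel_measurable M"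
    and c: "\<And>t \<omega>. t < T \<Longrightarrow> \<omega> \<in> space M \<Longrightarrow> norm (f t \<omega>) \<le> c"
  shows "Linf_norm M T f \<le> ereal (real T * c)"
  unfolding Linf_norm_def
proof (rule esssup_I)
  show "(\<lambda>\<omega>. ereal (L2_set (\<lambda>t. norm (f t \<omega>)) {..<T})) \<in> borel_measurable M"
    unfolding L2_set_def using f
    by (intro borel_measurable_ereal borel_measurable_sqrt[THEN measurable_compose_rev]
        borel_measurable_sum borel_measurable_power borel_measurable_norm[THEN measurable_compose_rev]) auto
  \<comment> \<open>Comparing the Euclidean norm with the sum of the norms is crude, but the factor
    \<open>T\<close> is fixed and does not affect convergence.\<close>
  have "L2_set (\<lambda>t. norm (f t \<omega>)) {..<T} \<le> real T * c" if "\<omega> \<in> space M" for \<omega>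
  proof -
    have "L2_set (\<lambda>t. norm (f t \<omega>)) {..<T} \<le> (\<Sum>t<T. norm (f t \<omega>))"
      by (rule L2_set_le_sum) simp
    also have "\<dots> \<le> (\<Sum>t<T. c)" using c that by (intro sum_mono) auto
    finally show ?thesis by simp
  qed
  then show "AE \<omega> in M. ereal (L2_set (\<lambda>t. norm (f t \<omega>)) {..<T}) \<le> ereal (real T * c)"
    by auto
qed

text \<open>\<open>W\<close> abstracts the pairing of the model with one selection \<open>Z\<close>.
  The event in \<open>local_W\<close> on which two strategies agree need not belong to any
  \<open>F t\<close>; the property comes from applying (A2) at one time after another.\<close>

locale usc_functional = prob_space M for M :: "'a measure" +
  fixes T :: nat and F :: "nat \<Rightarrow> 'a measure"
    and W :: "(nat \<Rightarrow> 'a \<Rightarrow> real ^ 'd::finite) \<Rightarrow> 'a \<Rightarrow> ereal"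
  assumes subalgebra: "\<And>t. t < T \<Longrightarrow> subalgebra M (F t)"
    and measurable_W: "\<And>\<theta>. \<theta> \<in> strategies T F \<Longrightarrow> W \<theta> \<in> borel_measurable M"
    and local_W: "\<And>\<theta> \<theta>'. \<theta> \<in> strategies T F \<Longrightarrow> \<theta>' \<in> strategies T F \<Longrightarrow>
      AE \<omega> in M. (\<forall>t<T. \<theta> t \<omega> = \<theta>' t \<omega>) \<longrightarrow> W \<theta> \<omega> = W \<theta>' \<omega>"
    and usc_W: "\<And>\<theta>s \<theta>. \<theta> \<in> strategies T F \<Longrightarrow> (\<And>m. \<theta>s m \<in> strategies T F) \<Longrightarrow>
      (\<And>m. Linf_norm M T (\<theta>s m) < \<infinity>) \<Longrightarrow>
      (\<lambda>m. Linf_norm M T (\<lambda>t \<omega>. \<theta>s m t \<omega> - \<theta> t \<omega>)) \<longlonglongrightarrow> 0 \<Longrightarrow>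
      AE \<omega> in M. limsup (\<lambda>m. W (\<theta>s m) \<omega>) \<le> W \<theta> \<omega>"
begin

lemma strategy_measurable:
  assumes "\<theta> \<in> strategies T F" "t < T" shows "\<theta> t \<in> borel_measurable M"
  using assms measurable_from_subalg[OF subalgebra] by (auto simp: strategies_def)

text \<open>Finitely many approximants are chosen at each precision so that, outside a set of
  summable probability, one of them exceeds the level \<open>r\<close>; listing all of them gives one
  sequence converging in \<open>L\<^sup>\<infinity>\<close> to which upper semicontinuity applies.\<close>

lemma frequently_exceeds:
  fixes \<xi> :: "nat \<Rightarrow> nat \<Rightarrow> nat \<Rightarrow> 'a \<Rightarrow> real ^ 'd"
  assumes \<theta>: "\<theta> \<in> strategies T F"
    and bdd: "\<And>t \<omega>. t < T \<Longrightarrow> \<omega> \<in> space M \<Longrightarrow> norm (\<theta> t \<omega>) \<le> b"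
    and \<xi>: "\<And>m j. \<xi> m j \<in> strategies T F"
    and close: "\<And>m j t \<omega>. t < T \<Longrightarrow> \<omega> \<in> space M \<Longrightarrow> dist (\<xi> m j t \<omega>) (\<theta> t \<omega>) \<le> 1 / real (Suc m)"
  shows "AE \<omega> in M. (\<forall>m. \<exists>j. r < W (\<xi> m j) \<omega>) \<longrightarrow> r \<le> W \<theta> \<omega>"
proof -
  define S where "S m j = {\<omega> \<in> space M. r < W (\<xi> m j) \<omega>}" for m j
  have S: "S m j \<in> sets M" for m j
  proof -
    note measurable_W[OF \<xi>, measurable]
    show ?thesis unfolding S_def by measurable
  qed
  \<comment> \<open>On \<open>R m n\<close> some approximant of precision \<open>m\<close> exceeds
    \<open>r\<close>, but none of the first \<open>n\<close> does. These sets decrease to the empty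
    set in \<open>n\<close>, so \<open>n m\<close> can be chosen to make their measures summable for
    Borel-Cantelli.\<close>
  define R where "R m n = (\<Union>j. S m j) - (\<Union>j<n. S m j)" for m and n :: nat
  have R: "R m n \<in> sets M" for m n unfolding R_def using S by auto
  have "\<exists>n. measure M (R m n) < (1/2) ^ m" for m
  proof -
    have "(\<lambda>n. measure M (R m n)) \<longlonglongrightarrow> measure M (\<Inter>n. R m n)"
    proof (rule finite_Lim_measure_decseq)
      show "range (R m) \<subseteq> sets M" using R by auto
      show "decseq (R m)" unfolding R_def decseq_def by (auto simp: less_le_trans)
    qed
    moreover have "(\<Inter>n. R m n) = {}" unfolding R_def by auto
    ultimately have "(\<lambda>n. measure M (R m n)) \<longlonglongrightarrow> 0" by simp
    then have "\<forall>\<^sub>F n in sequentially. measure M (R m n) < (1/2) ^ m"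
      by (rule order_tendstoD) simp
    then show ?thesis by (auto simp: eventually_sequentially)
  qed
  then obtain n where n: "\<And>m. measure M (R m (n m)) < (1/2) ^ m" by metis
  have AE_R: "AE \<omega> in M. \<forall>\<^sub>F m in sequentially. \<omega> \<in> space M - R m (n m)"
  proof (rule borel_cantelli_AE1)
    show "R m (n m) \<in> sets M" for m by (rule R)
    show "emeasure M (R m (n m)) < \<infinity>" for m by (simp add: less_top[symmetric])
    show "summable (\<lambda>m. measure M (R m (n m)))"
      by (rule summable_comparison_test'[OF summable_geometric[of "1/2"], where N = 0])
        (use n in \<open>auto simp: less_imp_le\<close>)
  qed
  \<comment> \<open>The closed range \<open>{..n m}\<close> makes each block nonempty even if
    \<open>n m = 0\<close>, so the index set is infinite and can be enumerated by all natural
    numbers.\<close>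
  define I where "I = (SIGMA m:UNIV. {..n m})"
  have "infinite I"
  proof
    assume "finite I"
    then have "finite (fst ` I)" by simp
    moreover have "fst ` I = UNIV" unfolding I_def by (auto simp: image_iff)
    ultimately show False by simp
  qed
  then obtain e :: "nat \<Rightarrow> nat \<times> nat" where e: "bij_betw e UNIV I"
    using countableE_infinite[of I] bij_betw_inv_into by (metis uncountable_def countableI_type)
  \<comment> \<open>Since every block is finite, an arbitrary enumeration passes through each
    precision only finitely often, and the precision tends to infinity along it.\<close>
  have finite_block: "finite {i. fst (e i) < m}" for m
  proof -
    have "finite (SIGMA m':{..<m}. {..n m'})" by auto
    then have "finite (e -` (SIGMA m':{..<m}. {..n m'}))"
      using e by (intro finite_vimageI) (auto simp: bij_betw_def)
    moreover have "{i. fst (e i) < m} \<subseteq> e -` (SIGMA m':{..<m}. {..n m'})"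
    proof
      fix i assume "i \<in> {i. fst (e i) < m}"
      moreover have "e i \<in> I" using e by (auto simp: bij_betw_def)
      ultimately show "i \<in> e -` (SIGMA m':{..<m}. {..n m'})" by (cases "e i") (auto simp: I_def)
    qed
    ultimately show ?thesis by (rule rev_finite_subset)
  qed
  have fst_e: "filterlim (\<lambda>i. fst (e i)) sequentially sequentially"
    unfolding filterlim_at_top
  proof
    fix m
    show "\<forall>\<^sub>F i in sequentially. m \<le> fst (e i)"
      using finite_block[of m] unfolding cofinite_eq_sequentially[symmetric] eventually_cofinite
      by (simp add: not_le)
  qed
  define \<eta> where "\<eta> i = case_prod \<xi> (e i)" for i
  have \<eta>: "\<eta> i \<in> strategies T F" for i unfolding \<eta>_def by (simp add: case_prod_beta \<xi>)
  have close_\<eta>: "norm (\<eta> i t \<omega> - \<theta> t \<omega>) \<le> 1 / real (Suc (fst (e i)))" if "t < T" "\<omega> \<in> space M" for i t \<omega>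
    unfolding \<eta>_def using close[OF that] by (simp add: case_prod_beta dist_norm)
  have "AE \<omega> in M. limsup (\<lambda>i. W (\<eta> i) \<omega>) \<le> W \<theta> \<omega>"
  proof (rule usc_W[OF \<theta> \<eta>])
    fix i
    have "Linf_norm M T (\<eta> i) \<le> ereal (real T * (b + 1))"
    proof (rule Linf_norm_le)
      fix t \<omega> assume t: "t < T" "\<omega> \<in> space M"
      have "1 / real (Suc (fst (e i))) \<le> 1" by simp
      then show "norm (\<eta> i t \<omega>) \<le> b + 1"
        using close_\<eta>[OF t, of i] bdd[OF t] norm_triangle_sub[of "\<eta> i t \<omega>" "\<theta> t \<omega>"] by linarith
    qed (use strategy_measurable[OF \<eta>] in auto)
    then show "Linf_norm M T (\<eta> i) < \<infinity>" using le_less_trans by fastforce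
  next
    have lim: "(\<lambda>i. ereal (real T * (1 / real (Suc (fst (e i)))))) \<longlonglongrightarrow> ereal (real T * 0)"
      by (intro tendsto_intros filterlim_compose[OF LIMSEQ_Suc[OF lim_1_over_n, unfolded of_nat_Suc] fst_e, unfolded of_nat_Suc[symmetric]])
    show "(\<lambda>i. Linf_norm M T (\<lambda>t \<omega>. \<eta> i t \<omega> - \<theta> t \<omega>)) \<longlonglongrightarrow> 0"
    proof (rule tendsto_sandwich)
      show "\<forall>\<^sub>F i in sequentially. 0 \<le> Linf_norm M T (\<lambda>t \<omega>. \<eta> i t \<omega> - \<theta> t \<omega>)"
        by (simp add: Linf_norm_nonneg)
      show "\<forall>\<^sub>F i in sequentially. Linf_norm M T (\<lambda>t \<omega>. \<eta> i t \<omega> - \<theta> t \<omega>)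
          \<le> ereal (real T * (1 / real (Suc (fst (e i)))))"
        using strategy_measurable[OF \<eta>] strategy_measurable[OF \<theta>] close_\<eta>
        by (intro always_eventually allI Linf_norm_le) auto
      show "(\<lambda>i. ereal (real T * (1 / real (Suc (fst (e i)))))) \<longlonglongrightarrow> 0"
        using lim by (simp only: mult_zero_right zero_ereal_def)
    qed (rule tendsto_const)
  qed
  with AE_R AE_space show ?thesis
  proof eventually_elim
    case (elim \<omega>)
    show ?case
    proof
      assume ex: "\<forall>m. \<exists>j. r < W (\<xi> m j) \<omega>"
      \<comment> \<open>If the limsup were below \<open>r\<close>, only finitely many members of the
        sequence could reach \<open>r\<close> at \<open>\<omega>\<close>. From \<open>m0\<close> on,
        however, every block contains one that exceeds \<open>r\<close>, and different blocks have
        different indices.\<close>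
      have "r \<le> limsup (\<lambda>i. W (\<eta> i) \<omega>)"
      proof (rule ccontr)
        assume "\<not> ?thesis"
        then have "limsup (\<lambda>i. W (\<eta> i) \<omega>) < r" by simp
        then have "\<forall>\<^sub>F i in sequentially. W (\<eta> i) \<omega> < r" by (rule Limsup_lessD)
        then have fin: "finite {i. \<not> W (\<eta> i) \<omega> < r}"
          unfolding cofinite_eq_sequentially[symmetric] eventually_cofinite .
        obtain m0 where m0: "\<And>m. m \<ge> m0 \<Longrightarrow> \<omega> \<notin> R m (n m)"
          using elim(1) by (auto simp: eventually_sequentially)
        have "\<exists>i. fst (e i) = m \<and> \<not> W (\<eta> i) \<omega> < r" if m: "m \<ge> m0" for m
        proof -
          have "\<omega> \<in> (\<Union>j. S m j)" using ex elim(2) by (auto simp: S_def)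
          then obtain j where j: "j < n m" "\<omega> \<in> S m j" using m0[OF m] by (auto simp: R_def)
          then have "(m, j) \<in> I" by (auto simp: I_def)
          then obtain i where "e i = (m, j)" using e unfolding bij_betw_def by (metis imageE)
          then show ?thesis using j(2) by (intro exI[of _ i]) (auto simp: \<eta>_def S_def)
        qed
        then have "{m0..} \<subseteq> (\<lambda>i. fst (e i)) ` {i. \<not> W (\<eta> i) \<omega> < r}" by force
        then have "finite {m0..}" using fin finite_surj by blast
        then show False by (simp add: infinite_Ici)
      qed
      then show "r \<le> W \<theta> \<omega>" using elim(3) by simp
    qed
  qed
qed

text \<open>The fixed-level statement is applied simultaneously at all rational levels; a rational
  strictly between the two sides would contradict it.\<close>

lemma INF_SUP_approximants_le:
  assumes \<theta>: "\<theta> \<in> strategies T F"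
    and bdd: "\<And>t \<omega>. t < T \<Longrightarrow> \<omega> \<in> space M \<Longrightarrow> norm (\<theta> t \<omega>) \<le> b"
    and X: "\<And>m. countable (X m)" "\<And>m. X m \<subseteq> strategies T F"
    and close: "\<And>m \<xi> t \<omega>. \<xi> \<in> X m \<Longrightarrow> t < T \<Longrightarrow> \<omega> \<in> space M \<Longrightarrow>
      dist (\<xi> t \<omega>) (\<theta> t \<omega>) \<le> 1 / real (Suc m)"
  shows "AE \<omega> in M. (INF m. SUP \<xi>\<in>X m. W \<xi> \<omega>) \<le> W \<theta> \<omega>"
proof -
  \<comment> \<open>Inserting \<open>\<theta>\<close> guarantees a nonempty set to enumerate, also
    when \<open>X m\<close> is empty, and is harmless because \<open>\<theta>\<close> has distance 0
    from itself.\<close>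
  define \<xi> where "\<xi> m j = from_nat_into (insert \<theta> (X m)) j" for m j
  have \<xi>_in: "\<xi> m j \<in> insert \<theta> (X m)" for m j
    unfolding \<xi>_def by (rule from_nat_into) simp
  have range_\<xi>: "range (\<xi> m) = insert \<theta> (X m)" for m
    unfolding \<xi>_def using X(1) by (intro range_from_nat_into) auto
  have "AE \<omega> in M. \<forall>r::rat. (\<forall>m. \<exists>j. ereal (real_of_rat r) < W (\<xi> m j) \<omega>) \<longrightarrow> ereal (real_of_rat r) \<le> W \<theta> \<omega>"
    unfolding AE_all_countable
  proof (intro allI frequently_exceeds[OF \<theta> bdd])
    show "\<xi> m j \<in> strategies T F" for m j using \<xi>_in[of m j] X(2) \<theta> by auto
    show "dist (\<xi> m j t \<omega>) (\<theta> t \<omega>) \<le> 1 / real (Suc m)" if "t < T" "\<omega> \<in> space M" for m j t \<omega>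
      using \<xi>_in[of m j] close that by (cases "\<xi> m j = \<theta>") auto
  qed
  then show ?thesis
  proof eventually_elim
    case (elim \<omega>)
    show ?case
    proof (rule ccontr)
      assume "\<not> ?thesis"
      then have "W \<theta> \<omega> < (INF m. SUP \<xi>\<in>X m. W \<xi> \<omega>)" by (simp only: not_le)
      from ereal_dense3[OF this] obtain r :: rat
        where r: "W \<theta> \<omega> < ereal (real_of_rat r)" "ereal (real_of_rat r) < (INF m. SUP \<xi>\<in>X m. W \<xi> \<omega>)"
        by blast
      have "\<exists>j. ereal (real_of_rat r) < W (\<xi> m j) \<omega>" for m
      proof -
        have "ereal (real_of_rat r) < (SUP \<xi>\<in>X m. W \<xi> \<omega>)"
          using r(2) by (rule less_le_trans) (rule INF_lower, simp)
        then obtain x where "x \<in> X m" "ereal (real_of_rat r) < W x \<omega>"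
          unfolding less_SUP_iff by blast
        then show ?thesis using range_\<xi>[of m] by (metis image_iff insertI2)
      qed
      with elim r(1) show False using not_le by blast
    qed
  qed
qed

theorem pointwise_representation:
  obtains v where "v \<in> borel_measurable (M \<Otimes>\<^sub>M strat_borel T)"
    "\<And>\<theta>. \<theta> \<in> strategies T F \<Longrightarrow> AE \<omega> in M. W \<theta> \<omega> = v (\<omega>, strat_vector T \<theta> \<omega>)"
proof -
  obtain \<kappa> :: "nat \<Rightarrow> real ^ 'd \<Rightarrow> nat" where \<kappa>: "\<And>m. \<kappa> m \<in> borel \<rightarrow>\<^sub>M count_space UNIV"
    and \<kappa>_dist: "\<And>m x y. \<kappa> m x = \<kappa> m y \<Longrightarrow> dist x y < 1 / real (Suc m)"
    using fine_countable_cells by blast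
  \<comment> \<open>A cell of R^(dT) is a product of cells of R^d, one for each time. Lists of
    naturals form a countable type, so null sets can be collected over all cells and a choice
    depending on the cell stays measurable.\<close>
  define cell where "cell m x = map (\<lambda>t. \<kappa> m (x t)) [0..<T]" for m and x :: "nat \<Rightarrow> real ^ 'd"
  have cell_eq: "cell m x = cell m y \<longleftrightarrow> (\<forall>t<T. \<kappa> m (x t) = \<kappa> m (y t))" for m x y
    by (auto simp: cell_def)
  have cell_nth: "cell m x ! t = \<kappa> m (x t)" if "t < T" for m x t
    using that by (simp add: cell_def)
  have cell_strat_vector: "cell m (strat_vector T \<theta> \<omega>) = cell m (\<lambda>t. \<theta> t \<omega>)" for m \<theta> and \<omega> :: 'a
    by (auto simp: cell_def strat_vector_def)
  have cell_measurable: "cell m \<in> strat_borel T \<rightarrow>\<^sub>M count_space UNIV" for m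
  proof (subst measurable_count_space_eq2_countable, safe)
    fix l
    have comp: "(\<lambda>x. \<kappa> m (x t)) \<in> strat_borel T \<rightarrow>\<^sub>M count_space UNIV" if "t < T" for t
      unfolding strat_borel_def
      using that by (intro measurable_compose[OF _ \<kappa>] measurable_component_singleton) auto
    have "cell m -` {l} \<inter> space (strat_borel T) =
        (if length l = T then {x \<in> space (strat_borel T). \<forall>t\<in>{..<T}. \<kappa> m (x t) = l ! t} else {})"
    proof -
      have "cell m x = l \<longleftrightarrow> length l = T \<and> (\<forall>t\<in>{..<T}. \<kappa> m (x t) = l ! t)" for x
        unfolding cell_def list_eq_iff_nth_eq by auto
      then show ?thesis by auto
    qed
    moreover have "{x \<in> space (strat_borel T). \<forall>t\<in>{..<T}. \<kappa> m (x t) = l ! t} \<in> sets (strat_borel T)"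
    proof (rule sets.sets_Collect_finite_All)
      fix t assume "t \<in> {..<T}"
      then have "(\<lambda>x. \<kappa> m (x t)) -` {l ! t} \<inter> space (strat_borel T) \<in> sets (strat_borel T)"
        by (intro measurable_sets[OF comp]) auto
      also have "(\<lambda>x. \<kappa> m (x t)) -` {l ! t} \<inter> space (strat_borel T) =
          {x \<in> space (strat_borel T). \<kappa> m (x t) = l ! t}" by auto
      finally show "{x \<in> space (strat_borel T). \<kappa> m (x t) = l ! t} \<in> sets (strat_borel T)" .
    qed auto
    ultimately show "cell m -` {l} \<inter> space (strat_borel T) \<in> sets (strat_borel T)" by simp
  qed auto

  \<comment> \<open>Essential suprema over cells and the candidate \<open>v\<close>\<close>
  define A where "A m c = {\<eta> \<in> strategies T F. \<forall>\<omega>\<in>space M. cell m (\<lambda>t. \<eta> t \<omega>) = c}" for m c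
  have "\<forall>m c. \<exists>C. countable C \<and> C \<subseteq> A m c \<and>
      (\<forall>\<eta>\<in>A m c. AE \<omega> in M. W \<eta> \<omega> \<le> (SUP \<zeta>\<in>C. W \<zeta> \<omega>))"
  proof (intro allI)
    fix m c
    show "\<exists>C. countable C \<and> C \<subseteq> A m c \<and>
      (\<forall>\<eta>\<in>A m c. AE \<omega> in M. W \<eta> \<omega> \<le> (SUP \<zeta>\<in>C. W \<zeta> \<omega>))"
    proof (rule countable_essential_supremum[of "A m c" W])
      show "W \<eta> \<in> borel_measurable M" if "\<eta> \<in> A m c" for \<eta>
        using that by (intro measurable_W) (simp add: A_def)
    qed blast
  qed
  then obtain C where C': "\<forall>m c. countable (C m c) \<and> C m c \<subseteq> A m c \<and>
      (\<forall>\<eta>\<in>A m c. AE \<omega> in M. W \<eta> \<omega> \<le> (SUP \<zeta>\<in>C m c. W \<zeta> \<omega>))"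
    unfolding choice_iff by blast
  then have C: "\<And>m c. countable (C m c)" "\<And>m c. C m c \<subseteq> A m c"
      "\<And>m c \<eta>. \<eta> \<in> A m c \<Longrightarrow> AE \<omega> in M. W \<eta> \<omega> \<le> (SUP \<zeta>\<in>C m c. W \<zeta> \<omega>)"
    by auto
  have C_strategy: "\<eta> \<in> strategies T F" if "\<eta> \<in> C m c" for m c \<eta>
    using that C(2)[of m c] unfolding A_def by blast
  \<comment> \<open>For an empty \<open>C m c\<close> this supremum is minus infinity. Strategies in
    \<open>A m c\<close> stay in the cell at every point of the space, not just almost surely, which
    gives pointwise distance bounds later.\<close>
  define G where "G m c \<omega> = (SUP \<zeta>\<in>C m c. W \<zeta> \<omega>)" for m c \<omega>
  have G: "G m c \<in> borel_measurable M" for m c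
    unfolding G_def using C(1) measurable_W[OF C_strategy]
    by (intro borel_measurable_SUP) auto
  define v where "v p = (INF m. G m (cell m (snd p)) (fst p))" for p
  have v: "v \<in> borel_measurable (M \<Otimes>\<^sub>M strat_borel T)"
    unfolding v_def
  proof (intro borel_measurable_INF)
    fix m
    show "(\<lambda>p. G m (cell m (snd p)) (fst p)) \<in> borel_measurable (M \<Otimes>\<^sub>M strat_borel T)"
      by (rule measurable_compose_countable[where f = "\<lambda>c p. G m c (fst p)"])
        (auto intro: measurable_compose[OF measurable_fst G]
          measurable_compose[OF measurable_snd cell_measurable])
  qed auto

  \<comment> \<open>Lower bound for the candidate along a strategy\<close>
  have lower: "AE \<omega> in M. W \<theta> \<omega> \<le> v (\<omega>, strat_vector T \<theta> \<omega>)" if \<theta>: "\<theta> \<in> strategies T F" for \<theta>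
  proof -
    have "AE \<omega> in M. cell m (\<lambda>t. \<theta> t \<omega>) = c \<longrightarrow> W \<theta> \<omega> \<le> G m c \<omega>" for m c
    proof (cases "\<exists>\<omega>\<in>space M. cell m (\<lambda>t. \<theta> t \<omega>) = c")
      case False
      then show ?thesis by (intro AE_I2) auto
    next
      case True
      then obtain \<omega>0 where \<omega>0: "cell m (\<lambda>t. \<theta> t \<omega>0) = c" by blast
      \<comment> \<open>Whenever a component leaves its cell it is replaced by its value at
        \<open>\<omega>0\<close>, a fixed point of that cell. The test at time \<open>t\<close>
        looks at \<open>\<theta> t\<close> only, so adaptedness survives; where
        \<open>\<theta>\<close> lies in \<open>c\<close> nothing is changed.\<close>
      define \<eta> where "\<eta> t \<omega> = (if \<kappa> m (\<theta> t \<omega>) = \<kappa> m (\<theta> t \<omega>0) then \<theta> t \<omega> else \<theta> t \<omega>0)" for t \<omega>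
      have \<eta>: "\<eta> \<in> strategies T F"
        unfolding strategies_def \<eta>_def
      proof safe
        fix t assume "t < T"
        then have [measurable]: "\<theta> t \<in> borel_measurable (F t)" using \<theta> by (auto simp: strategies_def)
        note \<kappa>[of m, measurable]
        show "(\<lambda>\<omega>. if \<kappa> m (\<theta> t \<omega>) = \<kappa> m (\<theta> t \<omega>0) then \<theta> t \<omega> else \<theta> t \<omega>0) \<in> borel_measurable (F t)"
          by measurable
      qed
      moreover have "cell m (\<lambda>t. \<eta> t \<omega>) = c" for \<omega>
        unfolding \<omega>0[symmetric] cell_eq \<eta>_def by auto
      ultimately have "\<eta> \<in> A m c" by (auto simp: A_def)
      from C(3)[OF this] local_W[OF \<theta> \<eta>] show ?thesis
      proof eventually_elim
        case (elim \<omega>)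
        have "W \<theta> \<omega> = W \<eta> \<omega>" if "cell m (\<lambda>t. \<theta> t \<omega>) = c"
          using elim(2) that unfolding \<omega>0[symmetric] cell_eq by (auto simp: \<eta>_def)
        with elim(1) show ?case by (simp add: G_def)
      qed
    qed
    then have "AE \<omega> in M. \<forall>m c. cell m (\<lambda>t. \<theta> t \<omega>) = c \<longrightarrow> W \<theta> \<omega> \<le> G m c \<omega>"
      by (simp only: AE_all_countable) blast
    then show ?thesis
      by eventually_elim (auto simp: v_def cell_strat_vector intro!: INF_greatest)
  qed

  \<comment> \<open>Upper bound along a bounded strategy\<close>
  have upper: "AE \<omega> in M. v (\<omega>, strat_vector T \<theta> \<omega>) \<le> W \<theta> \<omega>"
    if \<theta>: "\<theta> \<in> strategies T F" and bdd: "\<And>t \<omega>. t < T \<Longrightarrow> \<omega> \<in> space M \<Longrightarrow> norm (\<theta> t \<omega>) \<le> b" for \<theta> b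
  proof -
    \<comment> \<open>Substituting on the event that all components lie in \<open>c\<close> would
      use future information, hence one test per time. For \<open>\<eta>\<close> in
      \<open>A m c\<close> each substitution moves \<open>\<theta> t\<close> by less than the mesh,
      and on the event that \<open>\<theta>\<close> lies in \<open>c\<close> the result is
      \<open>\<eta>\<close> at all times before \<open>T\<close>.\<close>
    define h where "h m c \<eta> t \<omega> = (if \<kappa> m (\<theta> t \<omega>) = c ! t then \<eta> t \<omega> else \<theta> t \<omega>)"
      for m and c :: "nat list" and \<eta> :: "nat \<Rightarrow> 'a \<Rightarrow> real ^ 'd" and t \<omega>
    have h: "h m c \<eta> \<in> strategies T F" if "\<eta> \<in> strategies T F" for m c \<eta>
      unfolding strategies_def h_def
    proof safe
      fix t assume "t < T"
      then have [measurable]: "\<theta> t \<in> borel_measurable (F t)" "\<eta> t \<in> borel_measurable (F t)"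
        using \<theta> that by (auto simp: strategies_def)
      note \<kappa>[of m, measurable]
      show "(\<lambda>\<omega>. if \<kappa> m (\<theta> t \<omega>) = c ! t then \<eta> t \<omega> else \<theta> t \<omega>) \<in> borel_measurable (F t)"
        by measurable
    qed
    define X where "X m = (\<Union>c. h m c ` C m c)" for m
    have AE_h: "AE \<omega> in M. \<forall>m c. \<forall>\<eta>\<in>C m c. (\<forall>t<T. h m c \<eta> t \<omega> = \<eta> t \<omega>) \<longrightarrow> W (h m c \<eta>) \<omega> = W \<eta> \<omega>"
      unfolding AE_all_countable AE_ball_countable[OF C(1)]
      by (intro allI ballI local_W h C_strategy)
    have "AE \<omega> in M. (INF m. SUP \<xi>\<in>X m. W \<xi> \<omega>) \<le> W \<theta> \<omega>"
    proof (rule INF_SUP_approximants_le[OF \<theta> bdd])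
      show "countable (X m)" for m unfolding X_def using C(1) by auto
      show "X m \<subseteq> strategies T F" for m unfolding X_def using h[OF C_strategy] by auto
      fix m \<xi> t \<omega> assume \<xi>: "\<xi> \<in> X m" and t: "t < T" and \<omega>: "\<omega> \<in> space M"
      obtain c \<eta> where \<eta>: "\<xi> = h m c \<eta>" "\<eta> \<in> A m c" using \<xi> C(2) unfolding X_def by blast
      have "c ! t = \<kappa> m (\<eta> t \<omega>)" using \<eta>(2) \<omega> cell_nth[OF t, of m "\<lambda>t. \<eta> t \<omega>"] by (auto simp: A_def)
      then show "dist (\<xi> t \<omega>) (\<theta> t \<omega>) \<le> 1 / real (Suc m)"
        using \<kappa>_dist[of m "\<eta> t \<omega>" "\<theta> t \<omega>"] by (auto simp: \<eta>(1) h_def less_imp_le)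
    qed
    with AE_h AE_space show ?thesis
    proof eventually_elim
      case (elim \<omega>)
      \<comment> \<open>At \<open>\<omega>\<close> every competitor from the cell of
        \<open>\<theta>\<close> agrees with its adapted modification, so locality transfers its
        value to a member of \<open>X m\<close>.\<close>
      have "G m (cell m (\<lambda>t. \<theta> t \<omega>)) \<omega> \<le> (SUP \<xi>\<in>X m. W \<xi> \<omega>)" for m
        unfolding G_def
      proof (rule SUP_least)
        let ?c = "cell m (\<lambda>t. \<theta> t \<omega>)"
        fix \<eta> assume \<eta>: "\<eta> \<in> C m ?c"
        have "h m ?c \<eta> t \<omega> = \<eta> t \<omega>" if "t < T" for t
          using cell_nth[OF that, of m "\<lambda>t. \<theta> t \<omega>"] by (simp add: h_def)
        then have "W \<eta> \<omega> = W (h m ?c \<eta>) \<omega>" using elim(1) \<eta> by auto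
        also have "\<dots> \<le> (SUP \<xi>\<in>X m. W \<xi> \<omega>)"
          using \<eta> by (intro SUP_upper) (auto simp: X_def)
        finally show "W \<eta> \<omega> \<le> (SUP \<xi>\<in>X m. W \<xi> \<omega>)" .
      qed
      then have "v (\<omega>, strat_vector T \<theta> \<omega>) \<le> (INF m. SUP \<xi>\<in>X m. W \<xi> \<omega>)"
        unfolding v_def by (intro INF_mono) (auto simp: cell_strat_vector)
      with elim(3) show ?case by simp
    qed
  qed

  \<comment> \<open>Removal of the boundedness assumption\<close>
  show thesis
  proof (rule that[OF v])
    fix \<theta> :: "nat \<Rightarrow> 'a \<Rightarrow> real ^ 'd" assume \<theta>: "\<theta> \<in> strategies T F"
    \<comment> \<open>Truncation at each time keeps adaptedness and gives bounded strategies. At a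
      fixed \<open>\<omega>\<close> the finitely many components are unchanged for some
      \<open>n\<close>, so locality carries the upper bound over to \<open>\<theta>\<close>.\<close>
    define tr where "tr n t \<omega> = (if norm (\<theta> t \<omega>) \<le> real n then \<theta> t \<omega> else 0)" for n t \<omega>
    have tr: "tr n \<in> strategies T F" for n
      unfolding strategies_def tr_def
    proof safe
      fix t assume "t < T"
      then have [measurable]: "\<theta> t \<in> borel_measurable (F t)" using \<theta> by (auto simp: strategies_def)
      show "(\<lambda>\<omega>. if norm (\<theta> t \<omega>) \<le> real n then \<theta> t \<omega> else 0) \<in> borel_measurable (F t)"
        by measurable
    qed
    have "AE \<omega> in M. \<forall>n. v (\<omega>, strat_vector T (tr n) \<omega>) \<le> W (tr n) \<omega>"
      unfolding AE_all_countable
    proof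
      fix n
      have "norm (tr n t \<omega>) \<le> real n" for t \<omega> by (simp add: tr_def)
      then show "AE \<omega> in M. v (\<omega>, strat_vector T (tr n) \<omega>) \<le> W (tr n) \<omega>" by (rule upper[OF tr])
    qed
    moreover have "AE \<omega> in M. \<forall>n. (\<forall>t<T. \<theta> t \<omega> = tr n t \<omega>) \<longrightarrow> W \<theta> \<omega> = W (tr n) \<omega>"
      unfolding AE_all_countable by (intro allI local_W \<theta> tr)
    ultimately show "AE \<omega> in M. W \<theta> \<omega> = v (\<omega>, strat_vector T \<theta> \<omega>)"
      using lower[OF \<theta>]
    proof eventually_elim
      case (elim \<omega>)
      obtain n :: nat where "(\<Sum>t<T. norm (\<theta> t \<omega>)) \<le> real n" using real_arch_simple by blast
      then have "norm (\<theta> t \<omega>) \<le> real n" if "t < T" for t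
        using that member_le_sum[of t "{..<T}" "\<lambda>t. norm (\<theta> t \<omega>)"] by simp
      then have eq: "\<theta> t \<omega> = tr n t \<omega>" if "t < T" for t using that by (simp add: tr_def)
      then have "strat_vector T \<theta> \<omega> = strat_vector T (tr n) \<omega>"
        unfolding strat_vector_def by (intro restrict_ext) auto
      moreover have "W \<theta> \<omega> = W (tr n) \<omega>" using elim(2) eq by blast
      ultimately show ?case using elim(1,3) by (simp add: order_antisym)
    qed
  qed
qed

end

section \<open>Polar cones and measurable projections\<close>

text \<open>Relative interior points are those through which every segment starting in
  \<open>S\<close> can be prolonged inside \<open>S\<close>. Adding \<open>e *\<^sub>R s\<close> to
  the prolonged point for \<open>z\<close> keeps it in the cone and yields the prolongation for
  \<open>z + s\<close>.\<close>

lemma rel_interior_cone_add: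
  fixes S :: "'b::euclidean_space set"
  assumes "convex S" "cone S" "z \<in> rel_interior S" "s \<in> S"
  shows "z + s \<in> rel_interior S"
proof -
  have ne: "S \<noteq> {}" using assms(4) by auto
  have "\<exists>e>1. (1 - e) *\<^sub>R x + e *\<^sub>R (z + s) \<in> S" if x: "x \<in> S" for x
  proof -
    obtain e where e: "e > 1" "(1 - e) *\<^sub>R x + e *\<^sub>R z \<in> S"
      using assms(3) x unfolding convex_rel_interior_iff[OF assms(1) ne] by blast
    moreover have "e *\<^sub>R s \<in> S" using assms(2,4) e(1) by (simp add: cone_def)
    ultimately have "((1 - e) *\<^sub>R x + e *\<^sub>R z) + e *\<^sub>R s \<in> S"
      using assms(1,2) convex_cone by blast
    then show ?thesis using e(1) by (intro exI[of _ e]) (simp add: algebra_simps)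
  qed
  then show ?thesis unfolding convex_rel_interior_iff[OF assms(1) ne] by blast
qed

lemma rel_interior_cone_scaleR:
  fixes S :: "'b::euclidean_space set"
  assumes "cone S" "z \<in> rel_interior S" "0 < c"
  shows "c *\<^sub>R z \<in> rel_interior S"
  using assms rel_interior_scaleR[of c S] cone_iff[of S] rel_interior_subset[of S] by force

text \<open>The cone contains 0, so its affine hull is its span and the segment from
  \<open>- x\<close> through \<open>z\<close> can be prolonged inside \<open>S\<close>. Dividing by
  \<open>e - 1\<close> gives \<open>x + (e / (e - 1)) *\<^sub>R z\<close> in \<open>S\<close>, and
  further multiples of \<open>z\<close> round the coefficient up to an integer.\<close>

lemma rel_interior_cone_absorbs:
  fixes S :: "'b::euclidean_space set"
  assumes "convex S" "cone S" "z \<in> rel_interior S" "x \<in> span S"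
  shows "\<exists>N::nat. x + real N *\<^sub>R z \<in> S"
proof -
  have z: "z \<in> S" using assms(3) rel_interior_subset by blast
  then have ne: "S \<noteq> {}" by auto
  have "0 \<in> S" using z assms(2) unfolding cone_def by (metis order_refl scaleR_zero_left)
  then have "affine hull S = span S" by (intro affine_hull_span_0) (simp add: hull_inc)
  then have "- x \<in> affine hull S" using assms(4) by (simp add: span_neg)
  then obtain e where e: "e > 1" "(1 - e) *\<^sub>R (- x) + e *\<^sub>R z \<in> S"
    using assms(3) unfolding convex_rel_interior_iff2[OF assms(1) ne] by blast
  obtain N :: nat where N: "e / (e - 1) \<le> real N" using real_arch_simple by blast
  have "(1 / (e - 1)) *\<^sub>R ((1 - e) *\<^sub>R (- x) + e *\<^sub>R z) \<in> S"
    using e assms(2) by (simp add: cone_def)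
  moreover have "(real N - e / (e - 1)) *\<^sub>R z \<in> S" using z assms(2) N by (simp add: cone_def)
  ultimately have "(1 / (e - 1)) *\<^sub>R ((1 - e) *\<^sub>R (- x) + e *\<^sub>R z)
      + (real N - e / (e - 1)) *\<^sub>R z \<in> S"
    using assms(1,2) convex_cone by blast
  moreover have "(1 / (e - 1)) *\<^sub>R ((1 - e) *\<^sub>R (- x) + e *\<^sub>R z) = x + (e / (e - 1)) *\<^sub>R z"
  proof -
    have "(1 - e) / (e - 1) = - 1" using e(1) by (simp add: field_simps)
    then have "(1 / (e - 1)) *\<^sub>R ((1 - e) *\<^sub>R (- x)) = x" by simp
    then show ?thesis by (simp only: scaleR_add_right) simp
  qed
  ultimately have "x + real N *\<^sub>R z \<in> S" by (simp add: algebra_simps)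
  then show ?thesis ..
qed

section \<open>The positive polar and Moreau's decomposition\<close>

lemma convex_positive_polar: "convex (positive_polar C)"
  unfolding positive_polar_def convex_alt by (auto simp: inner_add_right)

lemma cone_positive_polar: "cone (positive_polar C)"
  unfolding positive_polar_def cone_def by auto

lemma zero_in_positive_polar: "0 \<in> positive_polar C"
  unfolding positive_polar_def by auto

text \<open>The variational inequality of the projection is tested at the projection shifted by
  \<open>k\<close>.\<close>

lemma closest_point_cone_dot:
  fixes C :: "'b::euclidean_space set"
  assumes "closed C" "convex C" "cone C" "k \<in> C"
  shows "(x - closest_point C x) \<bullet> k \<le> 0"
proof -
  have "closest_point C x \<in> C" using assms by (intro closest_point_in_set) auto
  then have "closest_point C x + k \<in> C" using assms convex_cone by blast
  from closest_point_dot[OF assms(2,1) this, of x] show ?thesis by simp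
qed

text \<open>Moreau's decomposition: this is the projection of \<open>q\<close> onto the polar cone, expressed
  through the projection onto the primal cone, whose measurability in \<open>\<omega>\<close> is accessible.\<close>

definition polar_proj :: "(real ^ 'n) set \<Rightarrow> real ^ 'n \<Rightarrow> real ^ 'n" where
  "polar_proj C q = q + closest_point C (- q)"

context
  fixes C :: "(real ^ 'n::finite) set"
  assumes C: "closed C" "convex C" "cone C" "C \<noteq> {}"
begin

lemma polar_proj_in: "polar_proj C q \<in> positive_polar C"
  unfolding positive_polar_def polar_proj_def
proof safe
  fix k assume "k \<in> C"
  from closest_point_cone_dot[OF C(1-3) this, of "- q"]
  show "0 \<le> k \<bullet> (q + closest_point C (- q))"
    by (simp add: inner_add_right inner_diff_left inner_diff_right inner_commute)
qed

text \<open>For \<open>y\<close> in the polar, moving from 0 to \<open>z\<close> in \<open>C\<close>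
  changes the squared distance to \<open>- y\<close> by \<open>2 * (z \<bullet> y)\<close> plus the
  squared norm of \<open>z\<close>, which is nonnegative; hence 0 is the nearest point of
  \<open>C\<close>.\<close>

lemma polar_proj_id:
  assumes "y \<in> positive_polar C" shows "polar_proj C y = y"
proof -
  have "0 \<in> C" using C(3,4) cone_contains_0 by blast
  moreover have "\<forall>z\<in>C. dist (- y) 0 \<le> dist (- y) z"
  proof
    fix z assume "z \<in> C"
    then have "0 \<le> z \<bullet> y" using assms by (auto simp: positive_polar_def)
    then have "(norm y)\<^sup>2 \<le> (norm (- y - z))\<^sup>2"
      by (simp add: power2_norm_eq_inner inner_diff_left inner_diff_right inner_commute)
    then show "dist (- y) 0 \<le> dist (- y) z"
      by (simp add: dist_norm)
  qed
  ultimately have "0 = closest_point C (- y)" by (intro closest_point_unique[OF C(2,1)]) auto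
  then show ?thesis by (simp add: polar_proj_def)
qed

lemma continuous_polar_proj: "continuous_on UNIV (polar_proj C)"
  unfolding polar_proj_def
  by (intro continuous_intros continuous_on_compose2[OF continuous_on_closest_point[OF C(2,1,4), of UNIV]]) auto

text \<open>The residual \<open>y = c - x\<close> of the projection is itself in the polar, so
  \<open>0 \<le> x \<bullet> y\<close>. The variational inequality at 0 gives
  \<open>c \<bullet> y \<le> 0\<close>; hence \<open>y \<bullet> y \<le> 0\<close> and
  \<open>x\<close> equals its projection.\<close>

lemma bipolar:
  assumes "\<And>y. y \<in> positive_polar C \<Longrightarrow> 0 \<le> x \<bullet> y" shows "x \<in> C"
proof -
  define y where "y = polar_proj C (- x)"
  define c where "c = closest_point C x"
  have y: "y = c - x" by (simp add: y_def polar_proj_def c_def)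
  have "0 \<le> x \<bullet> y" using assms polar_proj_in unfolding y_def by blast
  moreover have "(x - c) \<bullet> (0 - c) \<le> 0" unfolding c_def
    using C cone_contains_0 by (intro closest_point_dot) auto
  moreover have "y \<bullet> y = c \<bullet> y - x \<bullet> y" unfolding y by (simp add: inner_diff_left)
  ultimately have "y \<bullet> y \<le> 0" unfolding y by (simp add: inner_diff_left inner_diff_right inner_commute)
  then have "x = c" using y by (metis eq_iff_diff_eq_0 inner_gt_zero_iff not_le)
  then show ?thesis unfolding c_def using C closest_point_in_set by metis
qed

text \<open>Projecting a dense set onto \<open>C\<close> gives enough test vectors, by continuity of
  the projection. With countable \<open>D\<close>, polar membership becomes a countable family of
  inequalities measurable in \<open>\<omega>\<close>.\<close>

lemma in_polar_if_dense:
  assumes D: "\<And>X. open X \<Longrightarrow> X \<noteq> {} \<Longrightarrow> \<exists>d\<in>D. d \<in> X"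
    and "\<And>q. q \<in> D \<Longrightarrow> 0 \<le> closest_point C q \<bullet> y"
  shows "y \<in> positive_polar C"
  unfolding positive_polar_def
proof safe
  fix x assume x: "x \<in> C"
  have "closed {q. 0 \<le> closest_point C q \<bullet> y}"
    by (intro closed_Collect_le continuous_intros continuous_on_closest_point C)
  then have "{q. 0 \<le> closest_point C q \<bullet> y} = UNIV"
    using D[of "- {q. 0 \<le> closest_point C q \<bullet> y}"] assms(2) by (auto simp: open_Compl)
  then have "0 \<le> closest_point C x \<bullet> y" by auto
  then show "0 \<le> x \<bullet> y" using closest_point_self[OF x] by simp
qed

end

text \<open>The angle at the projection is obtuse. Quantitatively, points of \<open>C\<close> that
  almost realise the distance from \<open>x\<close> are close to the projection.\<close>

lemma closest_point_dist_bound: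
  fixes C :: "'b::euclidean_space set"
  assumes "convex C" "closed C" "s \<in> C"
  shows "(dist s (closest_point C x))\<^sup>2 \<le> (dist x s)\<^sup>2 - (dist x (closest_point C x))\<^sup>2"
  using closest_point_dot[OF assms, of x]
  by (simp add: dist_norm power2_norm_eq_inner inner_diff_left inner_diff_right inner_commute)

text \<open>The distance to the set is measurable because it is below \<open>r\<close> exactly when
  a ball of radius \<open>r\<close> is hit. The projection is then the limit of dense points that
  lie near the set and almost realise this distance, selected by least index.\<close>

lemma borel_measurable_closest_point:
  fixes C :: "'a \<Rightarrow> 'b::euclidean_space set"
  assumes meas: "measurable_set_map M C"
    and C: "\<And>\<omega>. \<omega> \<in> space M \<Longrightarrow> closed (C \<omega>)" "\<And>\<omega>. \<omega> \<in> space M \<Longrightarrow> convex (C \<omega>)"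
      "\<And>\<omega>. \<omega> \<in> space M \<Longrightarrow> C \<omega> \<noteq> {}"
  shows "(\<lambda>\<omega>. closest_point (C \<omega>) x) \<in> borel_measurable M"
proof -
  obtain D :: "'b set" where D: "countable D" "\<And>X. open X \<Longrightarrow> X \<noteq> {} \<Longrightarrow> \<exists>d\<in>D. d \<in> X"
    using countable_dense_setE by blast
  define d where "d = from_nat_into D"
  have d: "\<exists>k. d k \<in> X" if "open X" "X \<noteq> {}" for X
    using D(2)[OF that] from_nat_into_surj[OF D(1)] unfolding d_def by metis
  have hit: "Measurable.pred M (\<lambda>\<omega>. C \<omega> \<inter> ball y r \<noteq> {})" for y r
    using meas by (auto simp: measurable_set_map_def pred_def)
  define c where "c \<omega> = closest_point (C \<omega>) x" for \<omega>
  define \<delta> where "\<delta> \<omega> = dist x (c \<omega>)" for \<omega>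
  have c: "c \<omega> \<in> C \<omega>" if "\<omega> \<in> space M" for \<omega>
    unfolding c_def using C that by (intro closest_point_in_set) auto
  have [measurable]: "\<delta> \<in> borel_measurable M"
    unfolding borel_measurable_iff_less
  proof
    fix r
    have "\<delta> \<omega> < r \<longleftrightarrow> C \<omega> \<inter> ball x r \<noteq> {}" if \<omega>: "\<omega> \<in> space M" for \<omega>
      using c[OF \<omega>] closest_point_le[OF C(1)[OF \<omega>], of _ x] unfolding \<delta>_def c_def
      by (fastforce simp: disjoint_iff)
    then have "{\<omega> \<in> space M. \<delta> \<omega> < r} = {\<omega> \<in> space M. C \<omega> \<inter> ball x r \<noteq> {}}" by auto
    then show "{\<omega> \<in> space M. \<delta> \<omega> < r} \<in> sets M" using hit[of x r] by (simp add: pred_def)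
  qed
  define \<epsilon> where "\<epsilon> m = 1 / real (Suc m)" for m
  have \<epsilon>: "\<epsilon> m > 0" for m by (simp add: \<epsilon>_def)
  have \<epsilon>_lim: "\<epsilon> \<longlonglongrightarrow> 0" unfolding \<epsilon>_def using LIMSEQ_inverse_real_of_nat by (simp add: inverse_eq_divide)
  define P where "P m k \<omega> \<longleftrightarrow> C \<omega> \<inter> ball (d k) (\<epsilon> m) \<noteq> {} \<and> dist x (d k) < \<delta> \<omega> + \<epsilon> m" for m k \<omega>
  have [measurable]: "Measurable.pred M (P m k)" for m k
    unfolding P_def using hit[of "d k" "\<epsilon> m", measurable] by measurable
  define u where "u m \<omega> = d (LEAST k. P m k \<omega>)" for m \<omega>
  have u_meas: "u m \<in> borel_measurable M" for m
    unfolding u_def by (rule measurable_compose[where N = "count_space UNIV"]) simp_all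
  have bound: "dist (u m \<omega>) (c \<omega>) \<le> \<epsilon> m + sqrt (4 * \<epsilon> m * \<delta> \<omega> + 4 * (\<epsilon> m)\<^sup>2)" if \<omega>: "\<omega> \<in> space M" for m \<omega>
  proof -
    obtain k where k: "d k \<in> ball (c \<omega>) (\<epsilon> m)" using d[of "ball (c \<omega>) (\<epsilon> m)"] \<epsilon>[of m] by auto
    have "P m k \<omega>" unfolding P_def
    proof
      show "C \<omega> \<inter> ball (d k) (\<epsilon> m) \<noteq> {}" using k c[OF \<omega>] by (auto simp: dist_commute)
      show "dist x (d k) < \<delta> \<omega> + \<epsilon> m"
        using k dist_triangle[of x "d k" "c \<omega>"] by (simp add: \<delta>_def dist_commute)
    qed
    then have "P m (LEAST k. P m k \<omega>) \<omega>" by (rule LeastI)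
    then have "C \<omega> \<inter> ball (u m \<omega>) (\<epsilon> m) \<noteq> {}" and xu: "dist x (u m \<omega>) < \<delta> \<omega> + \<epsilon> m"
      unfolding u_def P_def[of m "LEAST k. P m k \<omega>" \<omega>] by auto
    then obtain s where s: "s \<in> C \<omega>" "dist (u m \<omega>) s < \<epsilon> m" by auto
    \<comment> \<open>Passing from \<open>x\<close> to \<open>u m \<omega>\<close> and then to
      \<open>s\<close> costs one \<open>\<epsilon> m\<close> each; squaring this excess of
      \<open>2 * \<epsilon> m\<close> produces the terms under the root.\<close>
    have xs: "dist x s \<le> \<delta> \<omega> + 2 * \<epsilon> m" using s(2) xu dist_triangle[of x s "u m \<omega>"] by simp
    have "(dist s (c \<omega>))\<^sup>2 \<le> (dist x s)\<^sup>2 - (\<delta> \<omega>)\<^sup>2"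
      unfolding c_def \<delta>_def by (rule closest_point_dist_bound[OF C(2,1)[OF \<omega>] s(1)])
    also have "\<dots> \<le> (\<delta> \<omega> + 2 * \<epsilon> m)\<^sup>2 - (\<delta> \<omega>)\<^sup>2" using xs by (simp add: power_mono)
    also have "\<dots> = 4 * \<epsilon> m * \<delta> \<omega> + 4 * (\<epsilon> m)\<^sup>2" by (simp add: power2_eq_square algebra_simps)
    finally have "dist s (c \<omega>) \<le> sqrt (4 * \<epsilon> m * \<delta> \<omega> + 4 * (\<epsilon> m)\<^sup>2)" by (rule real_le_rsqrt)
    then show ?thesis using s(2) dist_triangle[of "u m \<omega>" "c \<omega>" s] by simp
  qed
  have "c \<in> borel_measurable M"
  proof (rule borel_measurable_LIMSEQ_metric[OF u_meas])
    fix \<omega> assume \<omega>: "\<omega> \<in> space M"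
    have "(\<lambda>m. dist (u m \<omega>) (c \<omega>)) \<longlonglongrightarrow> 0"
    proof (rule tendsto_sandwich)
      show "\<forall>\<^sub>F m in sequentially. 0 \<le> dist (u m \<omega>) (c \<omega>)" by simp
      show "\<forall>\<^sub>F m in sequentially. dist (u m \<omega>) (c \<omega>) \<le> \<epsilon> m + sqrt (4 * \<epsilon> m * \<delta> \<omega> + 4 * (\<epsilon> m)\<^sup>2)"
        by (intro always_eventually allI bound \<omega>)
      have "(\<lambda>m. \<epsilon> m + sqrt (4 * \<epsilon> m * \<delta> \<omega> + 4 * (\<epsilon> m)\<^sup>2)) \<longlonglongrightarrow> 0 + sqrt (4 * 0 * \<delta> \<omega> + 4 * 0\<^sup>2)"
        by (intro tendsto_intros \<epsilon>_lim)
      then show "(\<lambda>m. \<epsilon> m + sqrt (4 * \<epsilon> m * \<delta> \<omega> + 4 * (\<epsilon> m)\<^sup>2)) \<longlonglongrightarrow> 0" by simp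
    qed (rule tendsto_const)
    then show "(\<lambda>m. u m \<omega>) \<longlonglongrightarrow> c \<omega>" by (rule tendsto_dist_iff[THEN iffD2])
  qed
  then show ?thesis unfolding c_def .
qed

text \<open>Only nonnegative multiples are available in a cone, so a negative scalar exchanges the
  two terms of the difference. This form turns a dense sequence of the cone into a dense family of
  differences in its span.\<close>

lemma span_convex_cone:
  fixes S :: "'b::real_vector set"
  assumes "convex S" "cone S" "S \<noteq> {}"
  shows "span S = {x - y |x y. x \<in> S \<and> y \<in> S}" (is "_ = ?D")
proof (rule span_unique)
  have zero: "0 \<in> S" using assms cone_contains_0 by blast
  have add: "x + y \<in> S" if "x \<in> S" "y \<in> S" for x y using assms(1,2) convex_cone that by blast
  have scale: "c *\<^sub>R x \<in> S" if "x \<in> S" "0 \<le> c" for c x using assms(2) that by (simp add: cone_def)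
  show "S \<subseteq> ?D" using zero by force
  show "subspace ?D"
    unfolding subspace_def
  proof safe
    show "\<exists>x y. (0::'b) = x - y \<and> x \<in> S \<and> y \<in> S" using zero by force
    fix x y x' y' assume "x \<in> S" "y \<in> S" "x' \<in> S" "y' \<in> S"
    then show "\<exists>a b. (x - y) + (x' - y') = a - b \<and> a \<in> S \<and> b \<in> S"
      by (intro exI[of _ "x + x'"] exI[of _ "y + y'"]) (auto simp: add)
  next
    fix c :: real and x y assume xy: "x \<in> S" "y \<in> S"
    show "\<exists>a b. c *\<^sub>R (x - y) = a - b \<and> a \<in> S \<and> b \<in> S"
    proof (cases "0 \<le> c")
      case True
      then show ?thesis using xy
        by (intro exI[of _ "c *\<^sub>R x"] exI[of _ "c *\<^sub>R y"]) (auto simp: scale scaleR_diff_right)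
    next
      case False
      then show ?thesis using xy
        by (intro exI[of _ "(- c) *\<^sub>R y"] exI[of _ "(- c) *\<^sub>R x"]) (auto simp: scale scaleR_diff_right simp del: scaleR_minus_left, simp)
    qed
  qed
  show "?D \<subseteq> U" if "S \<subseteq> U" "subspace U" for U
    using that by (auto intro: subspace_diff)
qed

section \<open>A measurable frame of the polar cone\<close>

text \<open>The relative interior is nonempty and relatively open, so some \<open>\<zeta> i\<close>
  lies in it, and adding the remaining polar vectors does not leave it. A series over all
  \<open>k\<close> avoids choosing \<open>i\<close>, and so stays measurable when the
  \<open>\<zeta> k\<close> depend on \<open>\<omega>\<close>.\<close>

lemma weighted_sum_in_rel_interior:
  fixes C :: "(real ^ 'n::finite) set" and \<zeta> :: "nat \<Rightarrow> real ^ 'n"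
  assumes \<zeta>: "\<And>k. \<zeta> k \<in> positive_polar C"
    and dense: "\<And>y U. y \<in> positive_polar C \<Longrightarrow> open U \<Longrightarrow> y \<in> U \<Longrightarrow> \<exists>k. \<zeta> k \<in> U"
  shows "(\<Sum>k. ((1/2) ^ k / (1 + norm (\<zeta> k))) *\<^sub>R \<zeta> k) \<in> rel_interior (positive_polar C)"
proof -
  define w where "w k = (1/2) ^ k / (1 + norm (\<zeta> k))" for k
  have w: "w k > 0" for k unfolding w_def by (simp add: add_pos_nonneg)
  have summable: "summable (\<lambda>k. w k *\<^sub>R \<zeta> k)"
  proof (rule summable_comparison_test')
    show "summable (\<lambda>k. (1/2) ^ k :: real)" by (rule summable_geometric) simp
    fix k
    have "norm (\<zeta> k) / (1 + norm (\<zeta> k)) \<le> 1" by (simp add: divide_le_eq_1 add_pos_nonneg)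
    then have "(1/2) ^ k * (norm (\<zeta> k) / (1 + norm (\<zeta> k))) \<le> (1/2) ^ k * 1"
      by (intro mult_left_mono) auto
    then show "norm (w k *\<^sub>R \<zeta> k) \<le> (1/2) ^ k" using w[of k] by (simp add: w_def)
  qed
  obtain \<rho> where "\<rho> \<in> rel_interior (positive_polar C)"
    using rel_interior_eq_empty[OF convex_positive_polar, of C] zero_in_positive_polar[of C] by blast
  then obtain U where U: "open U" "\<rho> \<in> U \<inter> positive_polar C" "U \<inter> affine hull (positive_polar C) \<subseteq> positive_polar C"
    unfolding mem_rel_interior by blast
  then obtain i where "\<zeta> i \<in> U" using dense by blast
  then have "\<zeta> i \<in> rel_interior (positive_polar C)"
    unfolding mem_rel_interior using U \<zeta> by blast
  then have "w i *\<^sub>R \<zeta> i \<in> rel_interior (positive_polar C)"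
    by (intro rel_interior_cone_scaleR cone_positive_polar w)
  \<comment> \<open>Against each \<open>x\<close> in \<open>C\<close> the series has nonnegative
    terms, so it dominates its \<open>i\<close>-th term.\<close>
  moreover have "(\<Sum>k. w k *\<^sub>R \<zeta> k) - w i *\<^sub>R \<zeta> i \<in> positive_polar C"
    unfolding positive_polar_def
  proof safe
    fix x assume x: "x \<in> C"
    have "0 \<le> x \<bullet> (w k *\<^sub>R \<zeta> k)" for k
      using \<zeta>[of k] x w[of k] by (auto simp: positive_polar_def)
    then have "(\<Sum>k\<in>{i}. x \<bullet> (w k *\<^sub>R \<zeta> k)) \<le> (\<Sum>k. x \<bullet> (w k *\<^sub>R \<zeta> k))"
      by (intro sum_le_suminf bounded_linear.summable[OF bounded_linear_inner_right summable]) auto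
    also have "\<dots> = x \<bullet> (\<Sum>k. w k *\<^sub>R \<zeta> k)" by (rule bounded_linear.suminf[OF bounded_linear_inner_right summable, symmetric])
    finally show "0 \<le> x \<bullet> ((\<Sum>k. w k *\<^sub>R \<zeta> k) - w i *\<^sub>R \<zeta> i)" by (simp add: inner_diff_right)
  qed
  ultimately have "w i *\<^sub>R \<zeta> i + ((\<Sum>k. w k *\<^sub>R \<zeta> k) - w i *\<^sub>R \<zeta> i) \<in> rel_interior (positive_polar C)"
    by (intro rel_interior_cone_add convex_positive_polar cone_positive_polar)
  then show ?thesis by (simp add: w_def)
qed

text \<open>The sum is the orthogonal projection of \<open>y\<close>, which fixes \<open>y\<close>.
  The difference \<open>u\<close> lies in the span and is orthogonal to every residual
  \<open>axis i 1 - ?P i\<close>, hence to itself.\<close>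

lemma sum_closest_point_span:
  fixes y :: "real ^ 'n::finite"
  assumes "y \<in> span S"
  shows "(\<Sum>i\<in>UNIV. y $ i *\<^sub>R closest_point (span S) (axis i 1)) = y"
proof -
  let ?P = "\<lambda>i. closest_point (span S) (axis i 1)"
  define u where "u = (\<Sum>i\<in>UNIV. y $ i *\<^sub>R ?P i) - y"
  have P: "?P i \<in> span S" for i
    using span_zero[of S] by (intro closest_point_in_set closed_span) auto
  have u: "u \<in> span S" unfolding u_def using P assms by (intro span_diff span_sum span_scale)
  have "cone (span S)" by (simp add: cone_def span_scale)
  \<comment> \<open>Viewing the subspace as a cone gives one inequality; using it for
    \<open>u\<close> and \<open>- u\<close> gives orthogonality.\<close>
  then have "(axis i 1 - ?P i) \<bullet> l \<le> 0" if "l \<in> span S" for i l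
    using that closed_span subspace_imp_convex[OF subspace_span] by (intro closest_point_cone_dot)
  from this[OF u] this[OF span_neg[OF u]] have orth: "(axis i 1 - ?P i) \<bullet> u = 0" for i
    by (simp add: order_antisym)
  have "y = (\<Sum>i\<in>UNIV. y $ i *\<^sub>R axis i 1)"
    using basis_expansion[of y] by (simp add: scalar_mult_eq_scaleR)
  then have "u = (\<Sum>i\<in>UNIV. y $ i *\<^sub>R ?P i) - (\<Sum>i\<in>UNIV. y $ i *\<^sub>R axis i 1)" by (simp add: u_def)
  then have "u = (\<Sum>i\<in>UNIV. y $ i *\<^sub>R (?P i - axis i 1))"
    by (simp add: sum_subtractf scaleR_diff_right)
  then have "u \<bullet> u = (\<Sum>i\<in>UNIV. y $ i *\<^sub>R (?P i - axis i 1)) \<bullet> u" by simp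
  also have "\<dots> = (\<Sum>i\<in>UNIV. - (y $ i * ((axis i 1 - ?P i) \<bullet> u)))"
    unfolding inner_sum_left by (intro sum.cong) (auto simp: inner_diff_left right_diff_distrib)
  also have "\<dots> = 0" unfolding orth by simp
  finally show ?thesis by (simp add: u_def)
qed

lemma measurable_polar_frame:
  fixes K :: "'a \<Rightarrow> (real ^ 'n::finite) set"
  assumes meas: "measurable_set_map M K"
    and K: "\<And>\<omega>. \<omega> \<in> space M \<Longrightarrow> closed (K \<omega>)" "\<And>\<omega>. \<omega> \<in> space M \<Longrightarrow> convex (K \<omega>)"
      "\<And>\<omega>. \<omega> \<in> space M \<Longrightarrow> cone (K \<omega>)" "\<And>\<omega>. \<omega> \<in> space M \<Longrightarrow> K \<omega> \<noteq> {}"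
  obtains z :: "'a \<Rightarrow> real ^ 'n" and P :: "'n \<Rightarrow> 'a \<Rightarrow> real ^ 'n" and N :: "'n \<Rightarrow> 'a \<Rightarrow> nat"
  where "z \<in> borel_measurable M" "\<And>i. P i \<in> borel_measurable M" "\<And>i. N i \<in> M \<rightarrow>\<^sub>M count_space UNIV"
    "\<And>\<omega>. \<omega> \<in> space M \<Longrightarrow> z \<omega> \<in> rel_interior (positive_polar (K \<omega>))"
    "\<And>i \<omega>. \<omega> \<in> space M \<Longrightarrow> P i \<omega> + real (N i \<omega>) *\<^sub>R z \<omega> \<in> rel_interior (positive_polar (K \<omega>))"
    "\<And>\<omega> y. \<omega> \<in> space M \<Longrightarrow> y \<in> positive_polar (K \<omega>) \<Longrightarrow> (\<Sum>i\<in>UNIV. y $ i *\<^sub>R P i \<omega>) = y"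
proof -
  let ?K' = "\<lambda>\<omega>. positive_polar (K \<omega>)"
  obtain D :: "(real ^ 'n) set" where D: "countable D" "\<And>X. open X \<Longrightarrow> X \<noteq> {} \<Longrightarrow> \<exists>d\<in>D. d \<in> X"
    using countable_dense_setE by blast
  define d where "d = from_nat_into D"
  have d: "\<exists>k. d k \<in> X" if "open X" "X \<noteq> {}" for X
    using D(2)[OF that] from_nat_into_surj[OF D(1)] unfolding d_def by metis
  have cp_K: "(\<lambda>\<omega>. closest_point (K \<omega>) x) \<in> borel_measurable M" for x
    by (rule borel_measurable_closest_point[OF meas K(1,2,4)])
  define \<zeta> where "\<zeta> k \<omega> = polar_proj (K \<omega>) (d k)" for k \<omega>
  have \<zeta>_meas [measurable]: "\<zeta> k \<in> borel_measurable M" for k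
    unfolding \<zeta>_def polar_proj_def using cp_K by (intro borel_measurable_add borel_measurable_const)
  have \<zeta>: "\<zeta> k \<omega> \<in> ?K' \<omega>" if "\<omega> \<in> space M" for k \<omega>
    unfolding \<zeta>_def using K that by (intro polar_proj_in)
  have \<zeta>_dense: "\<exists>k. \<zeta> k \<omega> \<in> U" if "\<omega> \<in> space M" "y \<in> ?K' \<omega>" "open U" "y \<in> U" for y U \<omega>
  proof -
    have "open (polar_proj (K \<omega>) -` U)"
      using continuous_polar_proj[OF K[OF that(1)]] that(3) by (simp add: open_vimage)
    moreover have "y \<in> polar_proj (K \<omega>) -` U"
      using polar_proj_id[OF K[OF that(1)] that(2)] that(4) by simp
    ultimately show ?thesis using d unfolding \<zeta>_def by blast
  qed
  define z where "z \<omega> = (\<Sum>k. ((1/2) ^ k / (1 + norm (\<zeta> k \<omega>))) *\<^sub>R \<zeta> k \<omega>)" for \<omega>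
  have z_meas [measurable]: "z \<in> borel_measurable M"
    unfolding z_def by measurable
  have z: "z \<omega> \<in> rel_interior (?K' \<omega>)" if "\<omega> \<in> space M" for \<omega>
    unfolding z_def by (rule weighted_sum_in_rel_interior) (use \<zeta> \<zeta>_dense that in blast)+
  have span_meas: "measurable_set_map M (\<lambda>\<omega>. span (?K' \<omega>))"
    unfolding measurable_set_map_def
  proof safe
    fix U :: "(real ^ 'n) set" assume U: "open U"
    \<comment> \<open>Differences of the dense selections \<open>\<zeta> k\<close> are dense in the
      span, so hitting an open set is a countable union of measurable events.\<close>
    have "span (?K' \<omega>) \<inter> U \<noteq> {} \<longleftrightarrow> (\<exists>p q. \<zeta> p \<omega> - \<zeta> q \<omega> \<in> U)" if \<omega>: "\<omega> \<in> space M" for \<omega>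
    proof
      assume "\<exists>p q. \<zeta> p \<omega> - \<zeta> q \<omega> \<in> U"
      then show "span (?K' \<omega>) \<inter> U \<noteq> {}" using \<zeta>[OF \<omega>] span_base span_diff by (metis IntI empty_iff)
    next
      assume "span (?K' \<omega>) \<inter> U \<noteq> {}"
      moreover have "span (?K' \<omega>) = {x - y |x y. x \<in> ?K' \<omega> \<and> y \<in> ?K' \<omega>}"
        using zero_in_positive_polar by (intro span_convex_cone convex_positive_polar cone_positive_polar) auto
      ultimately obtain x y where xy: "x \<in> ?K' \<omega>" "y \<in> ?K' \<omega>" "x - y \<in> U" by auto
      have "open ((\<lambda>(a, b). a - b) -` U :: ((real ^ 'n) \<times> (real ^ 'n)) set)"
        using U by (intro open_vimage) (auto simp: case_prod_beta intro!: continuous_intros)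
      moreover have "(x, y) \<in> (\<lambda>(a, b). a - b) -` U" using xy(3) by simp
      ultimately obtain A B where AB: "open A" "open B" "(x, y) \<in> A \<times> B" "A \<times> B \<subseteq> (\<lambda>(a, b). a - b) -` U"
        by (rule open_prod_elim)
      obtain p where "\<zeta> p \<omega> \<in> A" using \<zeta>_dense[OF \<omega> xy(1) AB(1)] AB(3) by auto
      moreover obtain q where "\<zeta> q \<omega> \<in> B" using \<zeta>_dense[OF \<omega> xy(2) AB(2)] AB(3) by auto
      ultimately show "\<exists>p q. \<zeta> p \<omega> - \<zeta> q \<omega> \<in> U"
        using AB(4) by (intro exI[of _ p] exI[of _ q]) auto
    qed
    then have "{\<omega> \<in> space M. span (?K' \<omega>) \<inter> U \<noteq> {}} = {\<omega> \<in> space M. \<exists>p q. \<zeta> p \<omega> - \<zeta> q \<omega> \<in> U}"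
      by blast
    also have "\<dots> \<in> sets M"
      using borel_open[OF U, measurable] by measurable
    finally show "{\<omega> \<in> space M. span (?K' \<omega>) \<inter> U \<noteq> {}} \<in> sets M" .
  qed
  define P where "P i \<omega> = closest_point (span (?K' \<omega>)) (axis i 1)" for i \<omega>
  have P_meas [measurable]: "P i \<in> borel_measurable M" for i
    unfolding P_def
  proof (rule borel_measurable_closest_point[OF span_meas])
    show "span (?K' \<omega>) \<noteq> {}" for \<omega> using span_zero by blast
  qed (auto simp: closed_span subspace_imp_convex)
  have polar_iff: "y \<in> ?K' \<omega> \<longleftrightarrow> (\<forall>k. 0 \<le> closest_point (K \<omega>) (d k) \<bullet> y)" if \<omega>: "\<omega> \<in> space M" for y \<omega>
  proof
    assume "y \<in> ?K' \<omega>"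
    then show "\<forall>k. 0 \<le> closest_point (K \<omega>) (d k) \<bullet> y"
      using closest_point_in_set[OF K(1,4)[OF \<omega>]] by (auto simp: positive_polar_def)
  next
    assume *: "\<forall>k. 0 \<le> closest_point (K \<omega>) (d k) \<bullet> y"
    show "y \<in> ?K' \<omega>"
    proof (rule in_polar_if_dense[OF K[OF \<omega>], where D = "range d"])
      show "\<exists>a\<in>range d. a \<in> X" if "open X" "X \<noteq> {}" for X using d[OF that] by blast
    qed (use * in auto)
  qed
  \<comment> \<open>Integer coefficients allow a measurable choice by least element; the condition
    is membership in the polar, written through \<open>polar_iff\<close> as countably many
    measurable inequalities.\<close>
  define n where "n i \<omega> = (LEAST m. \<forall>k. 0 \<le> closest_point (K \<omega>) (d k) \<bullet> (P i \<omega> + real m *\<^sub>R z \<omega>))" for i \<omega>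
  have n_meas: "n i \<in> M \<rightarrow>\<^sub>M count_space UNIV" for i
  proof -
    note cp_K[measurable]
    show ?thesis unfolding n_def by measurable
  qed
  have n: "P i \<omega> + real (n i \<omega>) *\<^sub>R z \<omega> \<in> ?K' \<omega>" if \<omega>: "\<omega> \<in> space M" for i \<omega>
  proof -
    have "P i \<omega> \<in> span (?K' \<omega>)" unfolding P_def
      using span_zero[of "?K' \<omega>"] by (intro closest_point_in_set closed_span) auto
    then have "\<exists>m::nat. P i \<omega> + real m *\<^sub>R z \<omega> \<in> ?K' \<omega>"
      using z[OF \<omega>] by (intro rel_interior_cone_absorbs convex_positive_polar cone_positive_polar)
    then show ?thesis unfolding polar_iff[OF \<omega>] n_def by (rule LeastI_ex)
  qed
  show thesis
  \<comment> \<open>The coefficient \<open>n i\<close> only reaches the polar cone; the successor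
    adds one more \<open>z\<close>, which moves the vector into the relative interior.\<close>
  proof (rule that[of z P "\<lambda>i \<omega>. Suc (n i \<omega>)"])
    show "(\<lambda>\<omega>. Suc (n i \<omega>)) \<in> M \<rightarrow>\<^sub>M count_space UNIV" for i
      by (rule measurable_compose[OF n_meas]) simp
    fix i \<omega> assume \<omega>: "\<omega> \<in> space M"
    have "z \<omega> + (P i \<omega> + real (n i \<omega>) *\<^sub>R z \<omega>) \<in> rel_interior (?K' \<omega>)"
      by (intro rel_interior_cone_add convex_positive_polar cone_positive_polar z n \<omega>)
    then show "P i \<omega> + real (Suc (n i \<omega>)) *\<^sub>R z \<omega> \<in> rel_interior (?K' \<omega>)"
      by (simp add: algebra_simps)
  next
    fix \<omega> y assume "y \<in> ?K' \<omega>"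
    then show "(\<Sum>i\<in>UNIV. y $ i *\<^sub>R P i \<omega>) = y"
      unfolding P_def by (intro sum_closest_point_span span_base)
  qed (use z z_meas P_meas in auto)
qed

section \<open>Vector-valued market models\<close>

lemma measurable_option_if:
  assumes P: "Measurable.pred N P" and g: "g \<in> borel_measurable N"
  shows "(\<lambda>p. if P p then None else Some (g p)) \<in> N \<rightarrow>\<^sub>M (vec_minf_borel :: ('n::finite) vec_minf measure)"
proof (rule measurableI)
  fix A :: "'n vec_minf set" assume "A \<in> sets vec_minf_borel"
  then have "Some -` A \<in> sets borel" by (simp add: sets_vec_minf_borel)
  then have [measurable]: "Measurable.pred N (\<lambda>p. g p \<in> Some -` A)"
    using g by measurable
  note P[measurable]
  have "(\<lambda>p. if P p then None else Some (g p)) -` A \<inter> space N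
      = {p \<in> space N. if P p then None \<in> A else g p \<in> Some -` A}" by auto
  also have "\<dots> \<in> sets N" by measurable
  finally show "(\<lambda>p. if P p then None else Some (g p)) -` A \<inter> space N \<in> sets N" .
qed (simp add: space_vec_minf_borel)

lemma measurable_inner_minf:
  assumes Z: "Z \<in> borel_measurable M" and X: "X \<in> M \<rightarrow>\<^sub>M vec_minf_borel"
  shows "(\<lambda>\<omega>. inner_minf (Z \<omega>) (X \<omega>)) \<in> borel_measurable M"
proof -
  \<comment> \<open>The value 0 at minus infinity is arbitrary: the pairing below uses
    \<open>x\<close> only where \<open>X\<close> is finite.\<close>
  define x where "x a = (case a of None \<Rightarrow> 0 | Some y \<Rightarrow> y)" for a :: "'b vec_minf"
  have "x \<in> borel_measurable vec_minf_borel"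
  proof (rule measurableI)
    fix A :: "(real ^ 'b) set" assume "A \<in> sets borel"
    moreover have "Some -` (x -` A) = A" by (auto simp: x_def)
    ultimately show "x -` A \<inter> space vec_minf_borel \<in> sets vec_minf_borel"
      by (simp add: sets_vec_minf_borel space_vec_minf_borel)
  qed simp
  from measurable_compose[OF X this] have [measurable]: "(\<lambda>\<omega>. x (X \<omega>)) \<in> borel_measurable M" .
  have "{\<omega> \<in> space M. X \<omega> = None} = X -` {None} \<inter> space M" by auto
  also have "\<dots> \<in> sets M"
    by (rule measurable_sets[OF X]) (simp add: sets_vec_minf_borel vimage_def)
  finally have [measurable]: "Measurable.pred M (\<lambda>\<omega>. X \<omega> = None)" by (simp add: pred_def)
  note Z[measurable]
  have "(\<lambda>\<omega>. inner_minf (Z \<omega>) (X \<omega>)) = (\<lambda>\<omega>. if X \<omega> = None then - \<infinity> else ereal (Z \<omega> \<bullet> x (X \<omega>)))"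
    by (auto simp: fun_eq_iff inner_minf_def x_def split: option.split)
  also have "\<dots> \<in> borel_measurable M" by measurable
  finally show ?thesis .
qed

text \<open>Axiom (A2) alters a single time, so \<open>\<theta>\<close> is changed into
  \<open>\<theta>'\<close> through the hybrids \<open>h k\<close>, which follow
  \<open>\<theta>'\<close> before time \<open>k\<close> and \<open>\<theta>\<close> from then
  on.\<close>

lemma market_model_local:
  fixes V :: "(nat \<Rightarrow> 'a \<Rightarrow> real ^ 'd::finite) \<Rightarrow> 'a \<Rightarrow> (real ^ 'n::finite) option"
  assumes F: "finite_filtration M T F" and V: "market_model M T F V"
    and \<theta>: "\<theta> \<in> strategies T F" and \<theta>': "\<theta>' \<in> strategies T F"
  shows "AE \<omega> in M. (\<forall>t<T. \<theta> t \<omega> = \<theta>' t \<omega>) \<longrightarrow> V \<theta> \<omega> = V \<theta>' \<omega>"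
proof -
  define h where "h k t = (if t < k then \<theta>' t else \<theta> t)" for k t
  have h: "h k \<in> strategies T F" for k
    using \<theta> \<theta>' by (auto simp: strategies_def h_def)
  have loc: "AE \<omega> in M. \<omega> \<in> A \<longrightarrow> V \<eta> \<omega> = V (\<eta>(t := (\<lambda>\<omega>. indicator A \<omega> *\<^sub>R \<eta> t \<omega>))) \<omega>"
    if "t < T" "A \<in> sets (F t)" "\<eta> \<in> strategies T F" for t A \<eta>
    using V that unfolding market_model_def by blast
  have "AE \<omega> in M. (\<forall>t<T. \<theta> t \<omega> = \<theta>' t \<omega>) \<longrightarrow> V \<theta> \<omega> = V (h k) \<omega>" if "k \<le> T" for k
    using that
  proof (induction k)
    case 0
    then show ?case by (simp add: h_def)
  next
    case (Suc k)
    then have k: "k < T" by simp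
    have space: "space (F k) = space M"
      using F k by (simp add: finite_filtration_def subalgebra_def)
    define A where "A = {\<omega> \<in> space (F k). \<theta> k \<omega> = \<theta>' k \<omega>}"
    have [measurable]: "\<theta> k \<in> borel_measurable (F k)" "\<theta>' k \<in> borel_measurable (F k)"
      using \<theta> \<theta>' k by (auto simp: strategies_def)
    have A: "A \<in> sets (F k)" unfolding A_def by measurable
    \<comment> \<open>Consecutive hybrids differ only at time \<open>k\<close>, and there they agree
      on \<open>A\<close>. Multiplication by the indicator makes them identical, so (A2) applied to
      both gives equal values on \<open>A\<close>.\<close>
    have "(h k)(k := (\<lambda>\<omega>. indicator A \<omega> *\<^sub>R h k k \<omega>)) =
        (h (Suc k))(k := (\<lambda>\<omega>. indicator A \<omega> *\<^sub>R h (Suc k) k \<omega>))"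
      by (auto simp: fun_eq_iff h_def A_def indicator_def)
    with loc[OF k A h[of k]] loc[OF k A h[of "Suc k"]]
    have "AE \<omega> in M. \<omega> \<in> A \<longrightarrow> V (h k) \<omega> = V (h (Suc k)) \<omega>"
      by (auto elim: eventually_elim2)
    moreover have "AE \<omega> in M. (\<forall>t<T. \<theta> t \<omega> = \<theta>' t \<omega>) \<longrightarrow> V \<theta> \<omega> = V (h k) \<omega>"
      using Suc by simp
    ultimately show ?case using AE_space
      by eventually_elim (use k in \<open>auto simp: A_def space\<close>)
  qed
  from this[OF order_refl]
  have "AE \<omega> in M. (\<forall>t<T. \<theta> t \<omega> = \<theta>' t \<omega>) \<longrightarrow> V \<theta> \<omega> = V (h T) \<omega>" .
  \<comment> \<open>\<open>h T\<close> and \<open>\<theta>'\<close> agree before \<open>T\<close>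
    but may differ as functions afterwards, so the step uses that the model depends only on the
    components before \<open>T\<close>.\<close>
  moreover have "AE \<omega> in M. V (h T) \<omega> = V \<theta>' \<omega>"
    using V h[of T] \<theta>' unfolding market_model_def by (simp add: h_def)
  ultimately show ?thesis by eventually_elim auto
qed

theorem theorem5p5:
  fixes M :: "'a measure" and T :: nat and F :: "nat \<Rightarrow> 'a measure"
    and K :: "'a \<Rightarrow> (real ^ 'n::finite) set"
    and Vhat :: "(nat \<Rightarrow> 'a \<Rightarrow> real ^ 'd::finite) \<Rightarrow> 'a \<Rightarrow> (real ^ 'n) option"
  assumes "prob_space M"
    and "finite_filtration M T F"
    and "solid_cone_map M K"
    and "market_model M T F Vhat"
    and "upper_semicontinuous_model M T F K Vhat"
  shows "\<exists>V :: 'a \<times> (nat \<Rightarrow> real ^ 'd) \<Rightarrow> (real ^ 'n) option.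
           V \<in> M \<Otimes>\<^sub>M strat_borel T \<rightarrow>\<^sub>M vec_minf_borel
           \<and> (\<forall>\<theta>\<in>strategies T F.
                AE \<omega> in M. cone_equiv (K \<omega>) (Vhat \<theta> \<omega>) (V (\<omega>, strat_vector T \<theta> \<omega>)))"
proof -
  interpret prob_space M by fact
  have K: "\<And>\<omega>. \<omega> \<in> space M \<Longrightarrow> closed (K \<omega>)" "\<And>\<omega>. \<omega> \<in> space M \<Longrightarrow> convex (K \<omega>)"
      "\<And>\<omega>. \<omega> \<in> space M \<Longrightarrow> cone (K \<omega>)" "\<And>\<omega>. \<omega> \<in> space M \<Longrightarrow> K \<omega> \<noteq> {}"
    and K_meas: "measurable_set_map M K"
    using assms(3) by (auto simp: solid_cone_map_def)
  obtain z :: "'a \<Rightarrow> real ^ 'n" and P :: "'n \<Rightarrow> 'a \<Rightarrow> real ^ 'n" and N :: "'n \<Rightarrow> 'a \<Rightarrow> nat"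
    where meas: "z \<in> borel_measurable M" "\<And>i. P i \<in> borel_measurable M" "\<And>i. N i \<in> M \<rightarrow>\<^sub>M count_space UNIV"
    and z: "\<And>\<omega>. \<omega> \<in> space M \<Longrightarrow> z \<omega> \<in> rel_interior (positive_polar (K \<omega>))"
    and PN: "\<And>i \<omega>. \<omega> \<in> space M \<Longrightarrow> P i \<omega> + real (N i \<omega>) *\<^sub>R z \<omega> \<in> rel_interior (positive_polar (K \<omega>))"
    and P: "\<And>\<omega> y. \<omega> \<in> space M \<Longrightarrow> y \<in> positive_polar (K \<omega>) \<Longrightarrow> (\<Sum>i\<in>UNIV. y $ i *\<^sub>R P i \<omega>) = y"
    using measurable_polar_frame[OF K_meas K] by blast
  note meas[measurable]
  have scalar: "\<exists>v. v \<in> borel_measurable (M \<Otimes>\<^sub>M strat_borel T) \<and>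
      (\<forall>\<theta>\<in>strategies T F. AE \<omega> in M. inner_minf (Z \<omega>) (Vhat \<theta> \<omega>) = v (\<omega>, strat_vector T \<theta> \<omega>))"
    if Z: "Z \<in> borel_measurable M" "\<And>\<omega>. \<omega> \<in> space M \<Longrightarrow> Z \<omega> \<in> rel_interior (positive_polar (K \<omega>))" for Z
  proof -
    interpret usc_functional M T F "\<lambda>\<theta> \<omega>. inner_minf (Z \<omega>) (Vhat \<theta> \<omega>)"
    proof
      show "subalgebra M (F t)" if "t < T" for t
        using assms(2) that by (simp add: finite_filtration_def)
      show "(\<lambda>\<omega>. inner_minf (Z \<omega>) (Vhat \<theta> \<omega>)) \<in> borel_measurable M" if "\<theta> \<in> strategies T F" for \<theta>
        using assms(4) that by (intro measurable_inner_minf Z) (simp add: market_model_def)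
      show "AE \<omega> in M. (\<forall>t<T. \<theta> t \<omega> = \<theta>' t \<omega>) \<longrightarrow> inner_minf (Z \<omega>) (Vhat \<theta> \<omega>) = inner_minf (Z \<omega>) (Vhat \<theta>' \<omega>)"
        if "\<theta> \<in> strategies T F" "\<theta>' \<in> strategies T F" for \<theta> \<theta>'
        using market_model_local[OF assms(2,4) that] by eventually_elim simp
      have "AE \<omega> in M. Z \<omega> \<in> rel_interior (positive_polar (K \<omega>))" using Z(2) by auto
      then show "AE \<omega> in M. limsup (\<lambda>m. inner_minf (Z \<omega>) (Vhat (\<theta>s m) \<omega>)) \<le> inner_minf (Z \<omega>) (Vhat \<theta> \<omega>)"
        if "\<theta> \<in> strategies T F" "\<And>m. \<theta>s m \<in> strategies T F" "\<And>m. Linf_norm M T (\<theta>s m) < \<infinity>"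
          "(\<lambda>m. Linf_norm M T (\<lambda>t \<omega>. \<theta>s m t \<omega> - \<theta> t \<omega>)) \<longlonglongrightarrow> 0" for \<theta>s \<theta>
        using assms(5) Z(1) that unfolding upper_semicontinuous_model_def by blast
    qed
    show ?thesis by (rule pointwise_representation) blast
  qed
  obtain v where v [measurable]: "v \<in> borel_measurable (M \<Otimes>\<^sub>M strat_borel T)"
    and v_eq: "\<And>\<theta>. \<theta> \<in> strategies T F \<Longrightarrow>
      AE \<omega> in M. inner_minf (z \<omega>) (Vhat \<theta> \<omega>) = v (\<omega>, strat_vector T \<theta> \<omega>)"
    using scalar[OF meas(1) z] by blast
  have "\<forall>i. \<exists>u. u \<in> borel_measurable (M \<Otimes>\<^sub>M strat_borel T) \<and>
      (\<forall>\<theta>\<in>strategies T F. AE \<omega> in M.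
        inner_minf (P i \<omega> + real (N i \<omega>) *\<^sub>R z \<omega>) (Vhat \<theta> \<omega>) = u (\<omega>, strat_vector T \<theta> \<omega>))"
  proof
    fix i
    have "(\<lambda>\<omega>. P i \<omega> + real (N i \<omega>) *\<^sub>R z \<omega>) \<in> borel_measurable M" by measurable
    from scalar[OF this PN] show "\<exists>u. u \<in> borel_measurable (M \<Otimes>\<^sub>M strat_borel T) \<and>
      (\<forall>\<theta>\<in>strategies T F. AE \<omega> in M.
        inner_minf (P i \<omega> + real (N i \<omega>) *\<^sub>R z \<omega>) (Vhat \<theta> \<omega>) = u (\<omega>, strat_vector T \<theta> \<omega>))" .
  qed
  then obtain u where u [measurable]: "\<And>i. u i \<in> borel_measurable (M \<Otimes>\<^sub>M strat_borel T)"
    and u_eq: "\<And>i \<theta>. \<theta> \<in> strategies T F \<Longrightarrow> AE \<omega> in M.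
        inner_minf (P i \<omega> + real (N i \<omega>) *\<^sub>R z \<omega>) (Vhat \<theta> \<omega>) = u i (\<omega>, strat_vector T \<theta> \<omega>)"
    unfolding choice_iff by blast
  \<comment> \<open>Coordinate \<open>i\<close> recovers the pairing with \<open>P i\<close> by
    subtracting \<open>N i\<close> times the pairing with \<open>z\<close> from the pairing with
    \<open>P i + N i z\<close>. Along a strategy, \<open>real_of_ereal\<close> meets infinite
    arguments almost surely only where \<open>Vhat\<close> is \<open>None\<close>; there
    \<open>v\<close> is minus infinity and \<open>V\<close> is \<open>None\<close> as well.\<close>
  define g where "g p = (\<Sum>i\<in>UNIV. (real_of_ereal (u i p) - real (N i (fst p)) * real_of_ereal (v p)) *\<^sub>R axis i (1::real))"
    for p
  have [measurable]: "g \<in> borel_measurable (M \<Otimes>\<^sub>M strat_borel T)"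
    unfolding g_def by measurable
  define V where "V p = (if v p = - \<infinity> then None else Some (g p))" for p
  have "V \<in> M \<Otimes>\<^sub>M strat_borel T \<rightarrow>\<^sub>M vec_minf_borel"
    unfolding V_def by (rule measurable_option_if) measurable
  moreover have "AE \<omega> in M. cone_equiv (K \<omega>) (Vhat \<theta> \<omega>) (V (\<omega>, strat_vector T \<theta> \<omega>))"
    if \<theta>: "\<theta> \<in> strategies T F" for \<theta>
  proof -
    have "AE \<omega> in M. \<forall>i\<in>UNIV. inner_minf (P i \<omega> + real (N i \<omega>) *\<^sub>R z \<omega>) (Vhat \<theta> \<omega>) = u i (\<omega>, strat_vector T \<theta> \<omega>)"
      by (rule AE_finite_allI) (auto intro: u_eq[OF \<theta>])
    with v_eq[OF \<theta>] AE_space show ?thesis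
    proof eventually_elim
      case (elim \<omega>)
      let ?p = "(\<omega>, strat_vector T \<theta> \<omega>)"
      show ?case
      proof (cases "Vhat \<theta> \<omega>")
        case None
        then have "V ?p = None" using elim(1) by (simp add: V_def inner_minf_def)
        with None show ?thesis by (simp add: cone_equiv_def cone_geq_def)
      next
        case (Some y)
        have vp: "v ?p = ereal (z \<omega> \<bullet> y)" using elim(1) Some by (simp add: inner_minf_def)
        have up: "u i ?p = ereal (P i \<omega> \<bullet> y + real (N i \<omega>) * (z \<omega> \<bullet> y))" for i
          using elim(3) Some by (simp add: inner_minf_def inner_add_left)
        have g: "g ?p = (\<Sum>i\<in>UNIV. (P i \<omega> \<bullet> y) *\<^sub>R axis i 1)"
          by (simp add: g_def vp up)
        \<comment> \<open>The \<open>i\<close>-th coordinate of \<open>g ?p\<close> is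
          \<open>P i \<omega> \<bullet> y\<close>, so pairing with \<open>w\<close> pairs
          \<open>y\<close> with the frame expansion of \<open>w\<close>, which is \<open>w\<close>
          itself on the polar.\<close>
        have pairing: "g ?p \<bullet> w = y \<bullet> w" if "w \<in> positive_polar (K \<omega>)" for w
        proof -
          have "g ?p \<bullet> w = (\<Sum>i\<in>UNIV. (w $ i *\<^sub>R P i \<omega>) \<bullet> y)"
            unfolding g inner_sum_left by (intro sum.cong) (auto simp: inner_axis' mult.commute)
          also have "\<dots> = w \<bullet> y"
            using P[OF elim(2) that] by (simp only: inner_sum_left[symmetric])
          finally show ?thesis by (simp add: inner_commute)
        qed
        \<comment> \<open>Both differences have zero pairing with every polar vector, so the bipolar
          theorem places both of them in the cone.\<close>
        have "y - g ?p \<in> K \<omega>" "g ?p - y \<in> K \<omega>"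
          by (auto intro!: bipolar[OF K[OF elim(2)]] simp: inner_diff_left pairing)
        moreover have "V ?p = Some (g ?p)" by (simp add: V_def vp)
        ultimately show ?thesis using Some by (simp add: cone_equiv_def cone_geq_def)
      qed
    qed
  qed
  ultimately show ?thesis by blast
qed

end
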